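(* Let $W$ be the $2|1$-dimensional complex $\mathbb Z_2$-graded vector space with basis $w_1$ (odd), $w_2,w_3$ (even). Every $L_\infty$ structure $d=d_1+d_2+\cdots$ on $W$ with $d_1\neq 0$ is equivalent to its leading term $d_1$ (regarded as a codifferential with all other terms zero), and it is equivalent to exactly one of the two codifferentials $$\psi^{1,0,0}_2\qquad\text{or}\qquad \psi^{0,1,0}_1 .$$ Here $\psi^{1,0,0}_2$ is the linear map $w_1\mapsto w_2$, $w_2,w_3\mapsto 0$, and $\psi^{0,1,0}_1$ is the linear map $w_2\mapsto w_1$, $w_1,w_3\mapsto 0$. Thus there are exactly two equivalence classes of $L_\infty$ structures on $W$ whose leading term has degree $1$.
   Context: All spaces are $\mathbb Z_2$-graded over $\mathbb C$. $S(W)=\bigoplus_{n\ge1}S^n(W)$ is the ($\mathbb Z_2$-graded) symmetric coalgebra of $W$ (so $w_1^2=0$). Let $L_n=\mathrm{Hom}(S^n(W),W)$ and $L=\prod_{n\ge1}L_n=\mathrm{Hom}(S(W),W)$. $L$ is identified with the space of coderivations of $S(W)$ and is a $\mathbb Z_2$-graded Lie algebra under the graded commutator $[\cdot,\cdot]$ of coderivations. An $L_\infty$ structure (codifferential) on $W$ is an odd element $d=d_1+d_2+\cdots\in L$, $d_i\in L_i$, with $[d,d]=0$. The leading term of $d\ne0$ is its first nonvanishing $d_N$; it is itself a codifferential. Two codifferentials $d,d'$ are equivalent if $d'=g^{-1}dg$ for some (even) coalgebra automorphism $g$ of $S(W)$; such $g$ correspond to even elements $g=g_1+g_2+\cdots\in\mathrm{Hom}(S(W),W)$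 with $g_1:W\to W$ invertible. *)

theory Defs
  imports Complex_Main "HOL-Library.Multiset" "HOL-Library.Poly_Mapping"
begin

section \<open>Graded vector spaces with a homogeneous basis\<close>

text \<open>A \<open>\<int>\<^sub>2\<close>-graded complex vector space \<open>W\<close> is given by a homogeneous basis, namely a type
  \<open>'b\<close> with a parity on its elements. The linear order only serves to write monomials
  in a fixed order, which is what the Koszul signs below refer to.\<close>

class super_basis = linorder +
  fixes is_odd :: "'a \<Rightarrow> bool"

text \<open>The free complex vector space on a type \<open>'x\<close> is \<open>'x \<Rightarrow>\<^sub>0 complex\<close>.\<close>

definition smult :: "complex \<Rightarrow> ('x \<Rightarrow>\<^sub>0 complex) \<Rightarrow> ('x \<Rightarrow>\<^sub>0 complex)" where
  "smult c v = Poly_Mapping.map ((*) c) v"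

lemma lookup_smult: "Poly_Mapping.lookup (smult c v) i = c * Poly_Mapping.lookup v i"
  unfolding smult_def by (transfer, simp add: when_def)

global_interpretation free_vs: vector_space "smult :: complex \<Rightarrow> ('x \<Rightarrow>\<^sub>0 complex) \<Rightarrow> _"
  by unfold_locales
    (auto intro!: poly_mapping_eqI simp: lookup_smult lookup_add algebra_simps)

abbreviation lin :: "(('x \<Rightarrow>\<^sub>0 complex) \<Rightarrow> ('y \<Rightarrow>\<^sub>0 complex)) \<Rightarrow> bool" where
  "lin \<equiv> Vector_Spaces.linear smult smult"

abbreviation bas :: "'x \<Rightarrow> ('x \<Rightarrow>\<^sub>0 complex)" where
  "bas i \<equiv> Poly_Mapping.single i 1"

definition extend :: "('x \<Rightarrow> ('y \<Rightarrow>\<^sub>0 complex)) \<Rightarrow> ('x \<Rightarrow>\<^sub>0 complex) \<Rightarrow> ('y \<Rightarrow>\<^sub>0 complex)" where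
  "extend f v = (\<Sum>i\<in>Poly_Mapping.keys v. smult (Poly_Mapping.lookup v i) (f i))"


section \<open>The graded symmetric coalgebra\<close>

text \<open>A basis of \<open>S(W) = \<Oplus>\<^bsub>n\<ge>1\<^esub> S\<^sup>n(W)\<close>: nonempty monomials in the basis of \<open>W\<close>, in which odd
  basis vectors occur at most once. The multiset \<open>I\<close> stands for the product \<open>w\<^sup>I\<close> of its
  elements in increasing order.\<close>

typedef (overloaded) 'b mono =
  "{I :: 'b::super_basis multiset. I \<noteq> {#} \<and> (\<forall>i. is_odd i \<longrightarrow> count I i \<le> 1)}"
  morphisms mset_of mono
  by (rule exI[of _ "{#undefined#}"]) simp

type_synonym 'b space = "'b \<Rightarrow>\<^sub>0 complex"
type_synonym 'b sym = "'b mono \<Rightarrow>\<^sub>0 complex"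
type_synonym 'b sym2 = "('b mono \<times> 'b mono) \<Rightarrow>\<^sub>0 complex"

definition deg :: "'b::super_basis mono \<Rightarrow> nat" where
  "deg I = size (mset_of I)"

text \<open>Parities are represented by natural numbers, which matter modulo 2 only.\<close>

definition par :: "'b::super_basis mono \<Rightarrow> nat" where
  "par I = size (filter_mset is_odd (mset_of I))"

text \<open>\<open>koszul J K\<close> is the sign \<open>\<epsilon>\<close> with \<open>w\<^sup>J\<^sup>+\<^sup>K = \<epsilon> w\<^sup>J w\<^sup>K\<close>.\<close>

definition koszul :: "'b::super_basis mono \<Rightarrow> 'b mono \<Rightarrow> complex" where
  "koszul J K = (- 1) ^ card {(j, k). j \<in># mset_of J \<and> k \<in># mset_of K \<and> is_odd j \<and> is_odd k \<and> k < j}"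

definition binom :: "'b::super_basis mono \<Rightarrow> 'b mono \<Rightarrow> nat" where
  "binom I J = (\<Prod>i\<in>set_mset (mset_of I). count (mset_of I) i choose count (mset_of J) i)"

text \<open>The comultiplication
  \<open>\<Delta>(x\<^sub>1\<dots>x\<^sub>n) = \<Sum>\<^bsub>0<k<n\<^esub> \<Sum>\<^bsub>\<sigma>\<in>Sh(k,n-k)\<^esub> \<epsilon>(\<sigma>) x\<^bsub>\<sigma>(1)\<^esub>\<dots>x\<^bsub>\<sigma>(k)\<^esub> \<otimes> x\<^bsub>\<sigma>(k+1)\<^esub>\<dots>x\<^bsub>\<sigma>(n)\<^esub>\<close>
  on the monomial basis: the unshuffles of \<open>w\<^sup>I\<close> which give \<open>w\<^sup>J \<otimes> w\<^sup>K\<close> all have the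
  sign \<open>koszul J K\<close>, and there are \<open>binom I J\<close> of them.\<close>

definition splits :: "'b::super_basis mono \<Rightarrow> ('b mono \<times> 'b mono) set" where
  "splits I = {(J, K). mset_of J + mset_of K = mset_of I}"

lemma finite_submset: "finite {M. M \<subseteq># (I::'a multiset)}"
proof (induction I)
  case (add x I)
  have "{M. M \<subseteq># add_mset x I} \<subseteq> {M. M \<subseteq># I} \<union> add_mset x ` {M. M \<subseteq># I}"
  proof
    fix M assume M: "M \<in> {M. M \<subseteq># add_mset x I}"
    show "M \<in> {M. M \<subseteq># I} \<union> add_mset x ` {M. M \<subseteq># I}"
    proof (cases "x \<in># M")
      case True
      then obtain N where "M = add_mset x N" by (metis insert_DiffM)
      with M show ?thesis by auto
    next
      case False
      with M show ?thesis
        by (metis (no_types, lifting) UnI1 diff_single_trivial mem_Collect_eq subset_eq_diff_conv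
            add_mset_add_single)
    qed
  qed
  with add show ?case by (meson finite_UnI finite_imageI finite_subset)
qed simp

lemma finite_splits: "finite (splits I)"
proof -
  let ?A = "{M. M \<subseteq># mset_of I}"
  have "inj mset_of" by (simp add: inj_def mset_of_inject)
  then have "inj_on (map_prod mset_of mset_of) (splits I)"
    by (meson inj_on_subset prod.inj_map subset_UNIV)
  moreover have "map_prod mset_of mset_of ` splits I \<subseteq> ?A \<times> ?A"
    unfolding splits_def by (auto, (metis mset_subset_eq_add_left mset_subset_eq_add_right)+)
  ultimately show ?thesis
    using finite_imageD[OF finite_subset[OF _ finite_cartesian_product[OF finite_submset finite_submset]]]
    by blast
qed

definition comult :: "'b::super_basis sym \<Rightarrow> 'b sym2" where
  "comult = extend (\<lambda>I. \<Sum>(J, K)\<in>splits I.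
     Poly_Mapping.single (J, K) (koszul J K * of_nat (binom I J)))"

definition tensor :: "'b::super_basis sym \<Rightarrow> 'b sym \<Rightarrow> 'b sym2" where
  "tensor u v = (\<Sum>I\<in>Poly_Mapping.keys u. \<Sum>J\<in>Poly_Mapping.keys v.
     Poly_Mapping.single (I, J) (Poly_Mapping.lookup u I * Poly_Mapping.lookup v J))"

text \<open>\<open>F \<otimes> G\<close> for \<open>G\<close> of parity \<open>q\<close>: \<open>(F \<otimes> G)(a \<otimes> b) = (-1)\<^bsup>q|a|\<^esup> F a \<otimes> G b\<close>.\<close>

definition tensor_map ::
  "nat \<Rightarrow> ('b::super_basis sym \<Rightarrow> 'b sym) \<Rightarrow> ('b sym \<Rightarrow> 'b sym) \<Rightarrow> 'b sym2 \<Rightarrow> 'b sym2" where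
  "tensor_map q F G = extend (\<lambda>(I, J). smult ((- 1) ^ (q * par I)) (tensor (F (bas I)) (G (bas J))))"


section \<open>Coderivations and automorphisms\<close>

definition homogeneous :: "nat \<Rightarrow> ('b::super_basis sym \<Rightarrow> 'b sym) \<Rightarrow> bool" where
  "homogeneous p F \<longleftrightarrow> (\<forall>I. \<forall>J\<in>Poly_Mapping.keys (F (bas I)). even (par I + par J + p))"

definition coderivation :: "nat \<Rightarrow> ('b::super_basis sym \<Rightarrow> 'b sym) \<Rightarrow> bool" where
  "coderivation p D \<longleftrightarrow> lin D \<and> homogeneous p D \<and>
     (\<forall>v. comult (D v) = tensor_map 0 D id (comult v) + tensor_map p id D (comult v))"

definition coalgebra_automorphism :: "('b::super_basis sym \<Rightarrow> 'b sym) \<Rightarrow> bool" where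
  "coalgebra_automorphism g \<longleftrightarrow> lin g \<and> bij g \<and> homogeneous 0 g \<and>
     (\<forall>v. comult (g v) = tensor_map 0 g g (comult v))"

text \<open>The graded commutator of maps of parities \<open>p\<close> and \<open>q\<close>.\<close>

definition graded_commutator ::
  "nat \<Rightarrow> nat \<Rightarrow> ('b::super_basis sym \<Rightarrow> 'b sym) \<Rightarrow> ('b sym \<Rightarrow> 'b sym) \<Rightarrow> 'b sym \<Rightarrow> 'b sym" where
  "graded_commutator p q D E = (\<lambda>v. D (E v) - smult ((- 1) ^ (p * q)) (E (D v)))"

text \<open>The identification of coderivations with elements of \<open>L = Hom(S(W), W)\<close>:
  a coderivation \<open>D\<close> corresponds to its composition with the projection to \<open>W = S\<^sup>1(W)\<close>, and
  every element of \<open>L\<close> of parity \<open>p\<close> arises in this way from exactly one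
  coderivation of parity \<open>p\<close>. The space \<open>L\<^sub>n = Hom(S\<^sup>n(W), W)\<close> is the set of maps in \<open>L\<close> that
  vanish on \<open>S\<^sup>k(W)\<close> for \<open>k \<noteq> n\<close>.\<close>

definition proj_space :: "'b::super_basis sym \<Rightarrow> 'b space" where
  "proj_space = extend (\<lambda>I. if deg I = 1 then bas (THE i. mset_of I = {#i#}) else 0)"

definition corestriction :: "('b::super_basis sym \<Rightarrow> 'b sym) \<Rightarrow> 'b sym \<Rightarrow> 'b space" where
  "corestriction D = proj_space \<circ> D"

definition coder_of :: "nat \<Rightarrow> ('b::super_basis sym \<Rightarrow> 'b space) \<Rightarrow> 'b sym \<Rightarrow> 'b sym" where
  "coder_of p \<phi> = (THE D. coderivation p D \<and> corestriction D = \<phi>)"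

definition part :: "nat \<Rightarrow> ('b::super_basis sym \<Rightarrow> 'b space) \<Rightarrow> 'b sym \<Rightarrow> 'b space" where
  "part n \<phi> = \<phi> \<circ> extend (\<lambda>I. if deg I = n then bas I else 0)"


section \<open>\<open>L\<^sub>\<infinity>\<close> structures\<close>

definition L_infinity :: "('b::super_basis sym \<Rightarrow> 'b sym) set" where
  "L_infinity = {d. coderivation 1 d \<and> graded_commutator 1 1 d d = (\<lambda>v. 0)}"

text \<open>The term \<open>d\<^sub>n \<in> L\<^sub>n\<close> of \<open>d = d\<^sub>1 + d\<^sub>2 + \<dots>\<close>.\<close>

definition L_term :: "nat \<Rightarrow> ('b::super_basis sym \<Rightarrow> 'b sym) \<Rightarrow> 'b sym \<Rightarrow> 'b space" where
  "L_term n d = part n (corestriction d)"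

definition L_equiv :: "(('b::super_basis sym \<Rightarrow> 'b sym) \<times> ('b sym \<Rightarrow> 'b sym)) set" where
  "L_equiv = {(d, d'). d \<in> L_infinity \<and> d' \<in> L_infinity \<and>
     (\<exists>g. coalgebra_automorphism g \<and> d' = inv g \<circ> d \<circ> g)}"

text \<open>The linear map \<open>W \<rightarrow> W\<close> with \<open>w\<^sub>i \<mapsto> w\<^sub>j\<close> which kills the other basis vectors, as an
  element of \<open>L\<^sub>1\<close>.\<close>

definition unit_map :: "'b::super_basis \<Rightarrow> 'b \<Rightarrow> 'b sym \<Rightarrow> 'b space" where
  "unit_map i j = extend (\<lambda>I. if mset_of I = {#i#} then bas j else 0)"


section \<open>The space of dimension \<open>2|1\<close>\<close>

datatype basis21 = W1 | W2 | W3

instantiation basis21 :: super_basis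
begin

fun index21 :: "basis21 \<Rightarrow> nat" where
  "index21 W1 = 1" | "index21 W2 = 2" | "index21 W3 = 3"

definition less_eq_basis21 :: "basis21 \<Rightarrow> basis21 \<Rightarrow> bool" where
  "less_eq_basis21 x y \<longleftrightarrow> index21 x \<le> index21 y"

definition less_basis21 :: "basis21 \<Rightarrow> basis21 \<Rightarrow> bool" where
  "less_basis21 x y \<longleftrightarrow> index21 x < index21 y"

definition is_odd_basis21 :: "basis21 \<Rightarrow> bool" where
  "is_odd_basis21 x \<longleftrightarrow> x = W1"

instance
proof
  fix x y :: basis21
  show "x \<le> y \<Longrightarrow> y \<le> x \<Longrightarrow> x = y"
    by (cases x; cases y) (simp_all add: less_eq_basis21_def)
qed (auto simp: less_eq_basis21_def less_basis21_def)

end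

definition psi_100_2 :: "basis21 sym \<Rightarrow> basis21 sym" where
  "psi_100_2 = coder_of 1 (unit_map W1 W2)"

definition psi_010_1 :: "basis21 sym \<Rightarrow> basis21 sym" where
  "psi_010_1 = coder_of 1 (unit_map W2 W1)"

end

theory Submission
  imports Defs "HOL-Computational_Algebra.Formal_Power_Series"
begin

text \<open>The linear functionals on \<open>S(W)\<close> form the algebra of formal power series without constant term
  in an odd variable \<open>t\<^sub>1\<close> and even variables \<open>t\<^sub>2\<close>, \<open>t\<^sub>3\<close>, and transposition turns coderivations into
  vector fields and coalgebra automorphisms into coordinate changes. An odd vector field is
  \<open>Q = f \<partial>\<^sub>1 + t\<^sub>1 (a \<partial>\<^sub>2 + b \<partial>\<^sub>3)\<close> with \<open>f\<close>, \<open>a\<close>, \<open>b\<close> series in \<open>t\<^sub>2\<close>, \<open>t\<^sub>3\<close> and \<open>f(0) = 0\<close>, and \<open>Q\<^sup>2 = 0\<close> forces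
  \<open>f a = f b = 0\<close>, so that \<open>f = 0\<close> or \<open>a = b = 0\<close>. If \<open>a = b = 0\<close> and \<open>f\<close> has a linear term, then \<open>f\<close>
  serves as a new coordinate \<open>t\<^sub>2\<close> and \<open>Q\<close> becomes \<open>t\<^sub>2 \<partial>\<^sub>1\<close>. If \<open>f = 0\<close> and, after exchanging \<open>t\<^sub>2\<close> and
  \<open>t\<^sub>3\<close> if necessary, \<open>a(0) \<noteq> 0\<close>, then in the coordinates \<open>t\<^sub>1 a\<close>, \<open>t\<^sub>2\<close>, \<open>u\<close>, where \<open>u\<close> solves the transport
  equation \<open>a \<partial>\<^sub>2 u + b \<partial>\<^sub>3 u = 0\<close>, the field \<open>Q\<close> becomes \<open>t\<^sub>1 \<partial>\<^sub>2\<close>. The two normal forms differ, since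
  the image of \<open>t\<^sub>2 \<partial>\<^sub>1\<close> contains no nonzero odd series, while that of \<open>t\<^sub>1 \<partial>\<^sub>2\<close> contains \<open>t\<^sub>1\<close>.\<close>

subsection \<open>The dual algebra of the symmetric coalgebra\<close>

definition ev :: "('x \<Rightarrow> complex) \<Rightarrow> ('x \<Rightarrow>\<^sub>0 complex) \<Rightarrow> complex" where
  "ev F v = (\<Sum>x\<in>Poly_Mapping.keys v. Poly_Mapping.lookup v x * F x)"

definition delta :: "'x \<Rightarrow> 'x \<Rightarrow> complex" where
  "delta x y = (if y = x then 1 else 0)"

lemma ev_superset:
  assumes "finite S" "Poly_Mapping.keys v \<subseteq> S"
  shows "ev F v = (\<Sum>x\<in>S. Poly_Mapping.lookup v x * F x)"
  unfolding ev_def using assms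
  by (intro sum.mono_neutral_left) (auto simp: in_keys_iff)

lemma ev_add: "ev F (v + w) = ev F v + ev F w"
proof -
  let ?S = "Poly_Mapping.keys v \<union> Poly_Mapping.keys w"
  have "ev F u = (\<Sum>x\<in>?S. Poly_Mapping.lookup u x * F x)" if "u \<in> {v, w, v + w}" for u
    using that Poly_Mapping.keys_add[of v w] by (intro ev_superset) auto
  then show ?thesis
    by (simp add: lookup_add sum.distrib algebra_simps)
qed

lemma ev_smult: "ev F (smult c v) = c * ev F v"
proof -
  have "Poly_Mapping.keys (smult c v) \<subseteq> Poly_Mapping.keys v"
    by (auto simp: in_keys_iff lookup_smult)
  then show ?thesis
    by (simp add: ev_superset[of "Poly_Mapping.keys v"] lookup_smult sum_distrib_left mult.assoc)
qed

lemma ev_zero [simp]: "ev F 0 = 0"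
  by (simp add: ev_def)

lemma ev_single [simp]: "ev F (Poly_Mapping.single x c) = c * F x"
  by (simp add: ev_def)

lemma ev_sum: "ev F (\<Sum>i\<in>A. v i) = (\<Sum>i\<in>A. ev F (v i))"
  by (induction A rule: infinite_finite_induct) (auto simp: ev_add)

lemma ev_delta [simp]: "ev (delta x) v = Poly_Mapping.lookup v x"
  by (simp add: ev_def delta_def if_distrib in_keys_iff cong: if_cong)

lemma ev_scaled: "ev (\<lambda>x. c * F x) v = c * ev F v"
  by (simp add: ev_def sum_distrib_left mult_ac)

lemma ev_plus: "ev (\<lambda>x. F x + G x) v = ev F v + ev G v"
  by (simp add: ev_def sum.distrib algebra_simps)

lemma ev_extend: "ev F (extend f v) = ev (\<lambda>x. ev F (f x)) v"
  by (simp add: extend_def ev_sum ev_smult) (simp add: ev_def)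

lemma extend_bas [simp]: "extend f (bas x) = f x"
  by (simp add: extend_def)

lemma eq_by_ev: "(\<And>F. ev F v = ev F w) \<Longrightarrow> v = w"
  by (metis ev_delta poly_mapping_eqI)

lemma lin_iff:
  "lin f \<longleftrightarrow> (\<forall>u v. f (u + v) = f u + f v) \<and> (\<forall>c v. f (smult c v) = smult c (f v))"
  by (simp add: Vector_Spaces.linear_iff free_vs.vector_space_axioms)

lemma lin_add: "lin f \<Longrightarrow> f (u + v) = f u + f v"
  and lin_smult: "lin f \<Longrightarrow> f (smult c v) = smult c (f v)"
  by (auto simp: lin_iff)

lemma lin_zero: "lin f \<Longrightarrow> f 0 = 0"
  using lin_add[of f 0 0] by simp

lemma lin_extend: "lin (extend f)"
  unfolding lin_iff by (auto intro!: eq_by_ev simp: ev_extend ev_add ev_smult)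

lemma lin_sum: "lin f \<Longrightarrow> f (\<Sum>i\<in>A. v i) = (\<Sum>i\<in>A. f (v i))"
  by (induction A rule: infinite_finite_induct) (auto simp: lin_add lin_zero)

lemma bas_expansion: "v = (\<Sum>x\<in>Poly_Mapping.keys v. smult (Poly_Mapping.lookup v x) (bas x))"
  by (rule eq_by_ev) (simp add: ev_sum ev_smult, simp add: ev_def)

lemma lin_eq_extend: "lin f \<Longrightarrow> f = extend (\<lambda>x. f (bas x))"
proof
  fix v assume f: "lin f"
  have "f v = f (\<Sum>x\<in>Poly_Mapping.keys v. smult (Poly_Mapping.lookup v x) (bas x))"
    using bas_expansion[of v] by simp
  then show "f v = extend (\<lambda>x. f (bas x)) v"
    by (simp add: lin_sum[OF f] lin_smult[OF f] extend_def)
qed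

lemma lin_comp: "lin f \<Longrightarrow> lin g \<Longrightarrow> lin (f \<circ> g)"
  by (simp add: lin_iff)

definition dual :: "(('x \<Rightarrow>\<^sub>0 complex) \<Rightarrow> ('y \<Rightarrow>\<^sub>0 complex)) \<Rightarrow> ('y \<Rightarrow> complex) \<Rightarrow> 'x \<Rightarrow> complex" where
  "dual D F x = ev F (D (bas x))"

lemma ev_lin: "lin D \<Longrightarrow> ev F (D v) = ev (dual D F) v"
  by (subst lin_eq_extend, assumption) (simp add: ev_extend dual_def[abs_def])

lemma dual_comp: "lin D \<Longrightarrow> dual (D \<circ> E) F = dual E (dual D F)"
  by (rule ext) (simp add: dual_def ev_lin)

lemma dual_id [simp]: "dual id F = F" "dual (\<lambda>v. v) F = F"
  by (auto simp: dual_def fun_eq_iff)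

lemma dual_scaled: "dual D (\<lambda>x. c * F x) = (\<lambda>y. c * dual D F y)"
  by (rule ext) (simp add: dual_def ev_scaled)

lemma dual_plus: "dual D (\<lambda>x. F x + G x) = (\<lambda>y. dual D F y + dual D G y)"
  by (rule ext) (simp add: dual_def ev_plus)

lemma dual_minus: "dual D (\<lambda>x. - F x) = (\<lambda>y. - dual D F y)"
  using dual_scaled[of D "- 1" F] by simp

lemma dual_zero: "dual D (\<lambda>x. 0) = (\<lambda>y. 0)"
  by (rule ext) (simp add: dual_def ev_def)

lemma lin_eqI:
  assumes "lin D" "lin E" "\<And>x. dual D (delta x) = dual E (delta x)"
  shows "D = E"
proof -
  have "D (bas y) = E (bas y)" for y
    by (rule poly_mapping_eqI) (metis assms(3) dual_def ev_delta)
  then show ?thesis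
    using lin_eq_extend[OF assms(1)] lin_eq_extend[OF assms(2)] by simp
qed

text \<open>The hypothesis \<open>cont\<close> is continuity for the topology of pointwise convergence.\<close>

lemma ex_dual:
  fixes T :: "('y \<Rightarrow> complex) \<Rightarrow> 'x \<Rightarrow> complex"
  assumes add: "\<And>F G. T (\<lambda>y. F y + G y) = (\<lambda>x. T F x + T G x)"
    and scale: "\<And>c F. T (\<lambda>y. c * F y) = (\<lambda>x. c * T F x)"
    and cont: "\<And>x. \<exists>S. finite S \<and> (\<forall>F. (\<forall>y\<in>S. F y = 0) \<longrightarrow> T F x = 0)"
  shows "\<exists>D. lin D \<and> dual D = T"
proof -
  obtain S where S: "\<And>x. finite (S x)" "\<And>x F. (\<And>y. y \<in> S x \<Longrightarrow> F y = 0) \<Longrightarrow> T F x = 0"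
    using cont by metis
  define D where "D = extend (\<lambda>x. \<Sum>y\<in>S x. Poly_Mapping.single y (T (delta y) x))"
  have zero: "T (\<lambda>y. 0) = (\<lambda>x. 0)"
    using scale[of 0 "\<lambda>y. 0"] by simp
  have sum: "T (\<lambda>y. \<Sum>i\<in>A. F i y) = (\<lambda>x. \<Sum>i\<in>A. T (F i) x)" for F :: "'y \<Rightarrow> 'y \<Rightarrow> complex" and A
    by (induction A rule: infinite_finite_induct) (auto simp: zero add)
  have "dual D F x = T F x" for F x
  proof -
    \<comment> \<open>\<open>G\<close> cuts \<open>F\<close> off to the finite set
      \<open>S x\<close>. The difference \<open>H\<close> vanishes on \<open>S x\<close>, so
      \<open>T\<close> kills it at \<open>x\<close>, and on the finite combination \<open>G\<close>
      additivity and scaling suffice.\<close>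
    define G where "G = (\<lambda>y. \<Sum>z\<in>S x. F z * delta z y)"
    define H where "H = (\<lambda>y. F y + - 1 * G y)"
    have "H y = 0" if "y \<in> S x" for y
      using that S(1)[of x] by (simp add: G_def H_def delta_def if_distrib cong: if_cong)
    then have "T H x = 0"
      using S(2) by blast
    then have "T F x = T G x"
      by (simp only: H_def add scale) simp
    also have "\<dots> = (\<Sum>z\<in>S x. F z * T (delta z) x)"
      by (simp add: G_def sum scale)
    also have "\<dots> = dual D F x"
      by (simp add: D_def dual_def ev_sum mult.commute)
    finally show ?thesis by simp
  qed
  then show ?thesis
    using lin_extend D_def by blast
qed

section \<open>The convolution product dual to the comultiplication\<close>

definition conv :: "('b::super_basis mono \<Rightarrow> complex) \<Rightarrow> ('b mono \<Rightarrow> complex) \<Rightarrow> 'b mono \<Rightarrow> complex" where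
  "conv F G I = (\<Sum>(J, K)\<in>splits I. koszul J K * of_nat (binom I J) * (F J * G K))"

text \<open>For odd \<open>q\<close> this is the parity involution of the dual algebra. It carries
  the Koszul sign of moving a map of parity \<open>q\<close> past an argument.\<close>

definition twist :: "nat \<Rightarrow> ('b::super_basis mono \<Rightarrow> complex) \<Rightarrow> 'b mono \<Rightarrow> complex" where
  "twist q F I = (- 1) ^ (q * par I) * F I"

lemma twist_0 [simp]: "twist 0 F = F"
  by (rule ext) (simp add: twist_def)

lemma ev_comult: "ev (\<lambda>(J, K). F J * G K) (comult v) = ev (conv F G) v"
  by (simp add: comult_def ev_extend ev_sum conv_def[abs_def] case_prod_unfold)

lemma ev_tensor: "ev (\<lambda>(J, K). F J * G K) (tensor u v) = ev F u * ev G v"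
  by (simp add: tensor_def ev_sum) (simp add: ev_def sum_product mult_ac)

lemma ev_tensor_map:
  "ev (\<lambda>(J, K). F J * G K) (tensor_map q A B w)
    = ev (\<lambda>(J, K). twist q (dual A F) J * dual B G K) w"
  by (simp add: tensor_map_def ev_extend case_prod_unfold ev_smult twist_def dual_def
      ev_tensor[unfolded case_prod_unfold] mult.assoc)

text \<open>Products of dual basis functionals form the dual basis of the tensor square, so product
  functionals separate its points.\<close>

lemma sym2_eqI:
  fixes v w :: "'b::super_basis sym2"
  assumes "\<And>J K. ev (\<lambda>(J', K'). delta J J' * delta K K') v = ev (\<lambda>(J', K'). delta J J' * delta K K') w"
  shows "v = w"
proof (rule poly_mapping_eqI)
  fix x :: "'b mono \<times> 'b mono"
  have "(\<lambda>(J', K'). delta (fst x) J' * delta (snd x) K') = delta x"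
    by (auto simp: delta_def fun_eq_iff prod_eq_iff)
  then show "Poly_Mapping.lookup v x = Poly_Mapping.lookup w x"
    using assms[of "fst x" "snd x"] by simp
qed

text \<open>A map of parity \<open>p\<close> commutes with the parity involution up to the sign
  \<open>(-1)^p\<close>. For the converse, \<open>delta J\<close> is an eigenvector of the
  involution, and comparing eigenvalues at \<open>I\<close> gives the parity condition wherever the
  matrix entry is nonzero.\<close>

lemma homogeneous_iff: "homogeneous p D \<longleftrightarrow> (\<forall>F. dual D (twist 1 F) = (\<lambda>I. (- 1) ^ p * twist 1 (dual D F) I))"
proof
  assume h: "homogeneous p D"
  show "\<forall>F. dual D (twist 1 F) = (\<lambda>I. (- 1) ^ p * twist 1 (dual D F) I)"
  proof (intro allI ext)
    fix F I
    have "(- 1) ^ par J = (- 1) ^ (p + par I) * (1::complex)"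
      if "J \<in> Poly_Mapping.keys (D (bas I))" for J
    proof -
      have "even (par J) = even (p + par I)"
        using h that unfolding homogeneous_def by fastforce
      then show ?thesis
        by (cases "even (par J)") simp_all
    qed
    then show "dual D (twist 1 F) I = (- 1) ^ p * twist 1 (dual D F) I"
      by (simp add: dual_def twist_def ev_def sum_distrib_left power_add) (intro sum.cong; simp)
  qed
next
  assume h: "\<forall>F. dual D (twist 1 F) = (\<lambda>I. (- 1) ^ p * twist 1 (dual D F) I)"
  show "homogeneous p D"
    unfolding homogeneous_def
  proof (intro allI ballI)
    fix I J assume J: "J \<in> Poly_Mapping.keys (D (bas I))"
    have "twist 1 (delta J) = (\<lambda>I. (- 1) ^ par J * delta J I)"
      by (auto simp: twist_def delta_def)
    then have "dual D (twist 1 (delta J)) I = (- 1) ^ par J * dual D (delta J) I"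
      by (simp add: dual_scaled)
    then have "(- 1) ^ par J * dual D (delta J) I = (- 1) ^ p * ((- 1) ^ par I * dual D (delta J) I)"
      using h[rule_format, of "delta J"] by (auto simp: twist_def fun_eq_iff)
    moreover have "dual D (delta J) I \<noteq> 0"
      using J by (simp add: dual_def in_keys_iff)
    ultimately have eq: "(- 1) ^ par J = (- 1) ^ (p + par I) * (1::complex)"
      by (metis mult_cancel_right mult.assoc power_add mult_1_right)
    show "even (par I + par J + p)"
    proof (rule ccontr)
      assume "odd (par I + par J + p)"
      then have "even (par J) \<longleftrightarrow> odd (p + par I)"
        by (simp only: even_add) blast
      then show False
        using eq by (cases "even (par J)") simp_all
    qed
  qed
qed

text \<open>Pairing the co-Leibniz identity with a product of functionals gives the graded Leibniz
  rule for the transpose. Nothing is lost, since product functionals separate points.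
  \<open>twist p F\<close> is the sign of \<open>D\<close> passing the first tensor factor.\<close>

lemma coderivation_iff:
  "coderivation p D \<longleftrightarrow> lin D \<and> homogeneous p D \<and>
    (\<forall>F G. dual D (conv F G) = (\<lambda>I. conv (dual D F) G I + conv (twist p F) (dual D G) I))"
proof -
  have rhs: "ev (\<lambda>(J, K). F J * G K) (tensor_map 0 D id (comult v) + tensor_map p id D (comult v))
      = ev (\<lambda>I. conv (dual D F) G I + conv (twist p F) (dual D G) I) v" for F G v
    by (simp add: ev_add ev_tensor_map ev_comult ev_plus)
  have lhs: "lin D \<Longrightarrow> ev (\<lambda>(J, K). F J * G K) (comult (D v)) = ev (dual D (conv F G)) v" for F G v
    by (simp add: ev_comult ev_lin)
  show ?thesis
    unfolding coderivation_def
  proof (intro conj_cong refl iffI allI)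
    fix F G
    assume D: "lin D" "\<forall>v. comult (D v) = tensor_map 0 D id (comult v) + tensor_map p id D (comult v)"
    show "dual D (conv F G) = (\<lambda>I. conv (dual D F) G I + conv (twist p F) (dual D G) I)"
    proof
      fix I
      show "dual D (conv F G) I = conv (dual D F) G I + conv (twist p F) (dual D G) I"
        using lhs[OF D(1), of F G "bas I"] rhs[of F G "bas I"] D(2) by simp
    qed
  next
    fix v
    assume "lin D" "\<forall>F G. dual D (conv F G) = (\<lambda>I. conv (dual D F) G I + conv (twist p F) (dual D G) I)"
    then show "comult (D v) = tensor_map 0 D id (comult v) + tensor_map p id D (comult v)"
      by (intro sym2_eqI) (simp add: lhs rhs)
  qed
qed

text \<open>The second form asks for multiplicativity on the dual basis only, which already
  separates points. It serves for maps whose transpose is computed on the functionals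
  \<open>delta J\<close>.\<close>

lemma comult_morphism_iff:
  assumes "lin g"
  shows "(\<forall>v. comult (g v) = tensor_map 0 g g (comult v)) \<longleftrightarrow>
    (\<forall>F G. dual g (conv F G) = conv (dual g F) (dual g G))" (is ?A)
    and "(\<And>J K. dual g (conv (delta J) (delta K)) = conv (dual g (delta J)) (dual g (delta K))) \<Longrightarrow>
      \<forall>v. comult (g v) = tensor_map 0 g g (comult v)" (is "PROP ?B")
proof -
  have rhs: "ev (\<lambda>(J, K). F J * G K) (tensor_map 0 g g (comult v)) = ev (conv (dual g F) (dual g G)) v" for F G v
    by (simp add: ev_tensor_map ev_comult)
  have lhs: "ev (\<lambda>(J, K). F J * G K) (comult (g v)) = ev (dual g (conv F G)) v" for F G v
    by (simp add: ev_comult ev_lin assms)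
  show B: "PROP ?B"
    by (intro allI sym2_eqI) (simp add: lhs rhs)
  show ?A
  proof
    assume D: "\<forall>v. comult (g v) = tensor_map 0 g g (comult v)"
    show "\<forall>F G. dual g (conv F G) = conv (dual g F) (dual g G)"
    proof (intro allI ext)
      fix F G I
      show "dual g (conv F G) I = conv (dual g F) (dual g G) I"
        using lhs[of F G "bas I"] rhs[of F G "bas I"] D by simp
    qed
  qed (rule B, blast)
qed

lemma coalgebra_automorphism_iff:
  "coalgebra_automorphism g \<longleftrightarrow> lin g \<and> bij g \<and>
    (\<forall>F. dual g (twist 1 F) = twist 1 (dual g F)) \<and>
    (\<forall>F G. dual g (conv F G) = conv (dual g F) (dual g G))"
  unfolding coalgebra_automorphism_def homogeneous_iff using comult_morphism_iff(1)[of g] by auto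

lemma coalgebra_automorphism_comp:
  assumes "coalgebra_automorphism g" "coalgebra_automorphism h"
  shows "coalgebra_automorphism (g \<circ> h)"
  using assms by (simp add: coalgebra_automorphism_iff lin_comp bij_comp dual_comp)

lemma lin_inv: 
  assumes "lin g" "bij g"
  shows "lin (inv g)"
  unfolding lin_iff
proof (intro conjI allI)
  fix u v c
  have i: "inv g (g w) = w" "g (inv g w') = w'" for w w'
    using assms(2) by (simp_all add: bij_is_inj bij_is_surj surj_f_inv_f)
  show "inv g (u + v) = inv g u + inv g v"
    using i(1)[of "inv g u + inv g v"] by (simp add: lin_add[OF assms(1)] i(2))
  show "inv g (smult c v) = smult c (inv g v)"
    using i(1)[of "smult c (inv g v)"] by (simp add: lin_smult[OF assms(1)] i(2))
qed

lemma dual_inv: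
  assumes "lin g" "bij g"
  shows "dual (inv g) (dual g F) = F" "dual g (dual (inv g) F) = F"
proof -
  have "g \<circ> inv g = id" "inv g \<circ> g = id"
    using assms(2) by (simp_all add: bij_is_inj bij_is_surj surj_iff[symmetric])
  then show "dual (inv g) (dual g F) = F" "dual g (dual (inv g) F) = F"
    using dual_comp[OF assms(1), of "inv g" F] dual_comp[OF lin_inv[OF assms], of g F] by simp_all
qed

lemma coalgebra_automorphism_inv:
  assumes "coalgebra_automorphism g"
  shows "coalgebra_automorphism (inv g)"
proof -
  have g: "lin g" "bij g" "\<And>F. dual g (twist 1 F) = twist 1 (dual g F)"
    "\<And>F G. dual g (conv F G) = conv (dual g F) (dual g G)"
    using assms by (auto simp: coalgebra_automorphism_iff)
  show ?thesis
    unfolding coalgebra_automorphism_iff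
  proof (intro conjI allI)
    fix F G
    show "dual (inv g) (twist 1 F) = twist 1 (dual (inv g) F)"
      by (metis g dual_inv)
    show "dual (inv g) (conv F G) = conv (dual (inv g) F) (dual (inv g) G)"
      by (metis g dual_inv)
  qed (use g lin_inv bij_imp_bij_inv in auto)
qed

section \<open>Codifferentials and the equivalence relation\<close>

lemma L_infinity_iff: "d \<in> L_infinity \<longleftrightarrow> coderivation 1 d \<and> (\<forall>v. d (d v) = 0)"
proof -
  have "v - smult (- 1) v = 0 \<longleftrightarrow> v = 0" for v :: "'a sym"
  proof -
    have "v - smult (- 1) v = smult 2 v"
      by (rule poly_mapping_eqI) (simp only: lookup_minus lookup_smult, simp)
    then show ?thesis
      by (simp only: free_vs.scale_eq_0_iff) simp
  qed
  then show ?thesis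
    by (simp add: L_infinity_def graded_commutator_def fun_eq_iff del: free_vs.scale_minus_left)
qed

text \<open>Transposition reverses the order: the transpose of the conjugate is
  \<open>dual d\<close> conjugated by the algebra automorphism \<open>dual g\<close>, hence again an
  odd derivation.\<close>

lemma L_infinity_conj:
  assumes d: "d \<in> L_infinity" and g: "coalgebra_automorphism g"
  shows "inv g \<circ> d \<circ> g \<in> L_infinity"
proof -
  have G: "lin g" "bij g" "\<And>F. dual g (twist 1 F) = twist 1 (dual g F)"
    "\<And>F G. dual g (conv F G) = conv (dual g F) (dual g G)"
    using g by (auto simp: coalgebra_automorphism_iff)
  have H: "lin (inv g)" "\<And>F. dual (inv g) (twist 1 F) = twist 1 (dual (inv g) F)"
    "\<And>F G. dual (inv g) (conv F G) = conv (dual (inv g) F) (dual (inv g) G)"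
    using coalgebra_automorphism_inv[OF g] by (auto simp: coalgebra_automorphism_iff)
  have D: "lin d" "\<And>F. dual d (twist 1 F) = (\<lambda>I. - twist 1 (dual d F) I)"
    "\<And>F G. dual d (conv F G) = (\<lambda>I. conv (dual d F) G I + conv (twist 1 F) (dual d G) I)"
    "\<And>v. d (d v) = 0"
    using d by (auto simp: L_infinity_iff coderivation_iff homogeneous_iff)
  have dual_eq: "dual (inv g \<circ> d \<circ> g) F = dual g (dual d (dual (inv g) F))" for F
    by (simp add: dual_comp lin_comp D(1) H(1))
  have "coderivation 1 (inv g \<circ> d \<circ> g)"
    unfolding coderivation_iff homogeneous_iff dual_eq
    by (simp add: lin_comp G H D dual_plus dual_minus dual_inv[OF G(1,2)] del: One_nat_def)
  moreover have "(inv g \<circ> d \<circ> g) ((inv g \<circ> d \<circ> g) v) = 0" for v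
    using G(2) D(4) lin_zero[OF H(1)] by (simp add: bij_is_surj surj_f_inv_f)
  ultimately show ?thesis
    by (simp add: L_infinity_iff)
qed

lemma L_equiv_sym: "(d, d') \<in> L_equiv \<Longrightarrow> (d', d) \<in> L_equiv"
proof -
  assume "(d, d') \<in> L_equiv"
  then obtain g where g: "d \<in> L_infinity" "d' \<in> L_infinity" "coalgebra_automorphism g" "d' = inv g \<circ> d \<circ> g"
    by (auto simp: L_equiv_def)
  then have b: "bij g"
    by (simp add: coalgebra_automorphism_def)
  have "d = inv (inv g) \<circ> d' \<circ> inv g"
    using b by (auto simp: g(4) fun_eq_iff inv_inv_eq bij_is_surj surj_f_inv_f)
  then show ?thesis
    using g coalgebra_automorphism_inv[OF g(3)] unfolding L_equiv_def by blast
qed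

lemma L_equiv_trans:
  assumes "(d, d') \<in> L_equiv" "(d', d'') \<in> L_equiv"
  shows "(d, d'') \<in> L_equiv"
proof -
  obtain g h where g: "d \<in> L_infinity" "d'' \<in> L_infinity" "coalgebra_automorphism g" "d' = inv g \<circ> d \<circ> g"
    and h: "coalgebra_automorphism h" "d'' = inv h \<circ> d' \<circ> h"
    using assms by (auto simp: L_equiv_def)
  then have "d'' = inv (g \<circ> h) \<circ> d \<circ> (g \<circ> h)"
    by (simp add: o_inv_distrib coalgebra_automorphism_def comp_assoc)
  then show ?thesis
    using g h coalgebra_automorphism_comp unfolding L_equiv_def by blast
qed

lemma L_equivI:
  assumes "d \<in> L_infinity" "d' \<in> L_infinity" "coalgebra_automorphism g" "g \<circ> d' = d \<circ> g"
  shows "(d, d') \<in> L_equiv"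
proof -
  have "inj g"
    using assms(3) by (simp add: coalgebra_automorphism_def bij_is_inj)
  then have "d' = inv g \<circ> (g \<circ> d')"
    by (simp add: comp_assoc[symmetric])
  then have "d' = inv g \<circ> d \<circ> g"
    by (simp add: assms(4) comp_assoc)
  then show ?thesis
    using assms unfolding L_equiv_def by blast
qed

unbundle fps_syntax

subsection \<open>Functionals on the symmetric coalgebra of the \<open>2|1\<close>-dimensional space as power series\<close>

definition n1 :: "basis21 mono \<Rightarrow> nat" where "n1 I = count (mset_of I) W1"
definition n2 :: "basis21 mono \<Rightarrow> nat" where "n2 I = count (mset_of I) W2"
definition n3 :: "basis21 mono \<Rightarrow> nat" where "n3 I = count (mset_of I) W3"

lemmas n_defs = n1_def n2_def n3_def

definition mset21 :: "nat \<Rightarrow> nat \<Rightarrow> nat \<Rightarrow> basis21 multiset" where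
  "mset21 a b c = replicate_mset a W1 + replicate_mset b W2 + replicate_mset c W3"

definition mon :: "nat \<Rightarrow> nat \<Rightarrow> nat \<Rightarrow> basis21 mono" where
  "mon a b c = mono (mset21 a b c)"

lemma count_mset21 [simp]:
  "count (mset21 a b c) W1 = a" "count (mset21 a b c) W2 = b" "count (mset21 a b c) W3 = c"
  by (simp_all add: mset21_def)

lemma mset21_eqI:
  assumes "count M W1 = count N W1" "count M W2 = count N W2" "count M W3 = count N W3"
  shows "M = N"
proof (rule multiset_eqI)
  fix x show "count M x = count N x" using assms by (cases x) auto
qed

lemma mset_of_mon: "a \<le> 1 \<Longrightarrow> 0 < a + b + c \<Longrightarrow> mset_of (mon a b c) = mset21 a b c"
  unfolding mon_def
  by (rule mono_inverse) (auto simp: is_odd_basis21_def mset21_def)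

lemma n_mon [simp]:
  assumes "a \<le> 1" "0 < a + b + c"
  shows "n1 (mon a b c) = a" "n2 (mon a b c) = b" "n3 (mon a b c) = c"
  by (simp_all add: n_defs mset_of_mon[OF assms])

lemma mono21_eqI: "n1 I = n1 J \<Longrightarrow> n2 I = n2 J \<Longrightarrow> n3 I = n3 J \<Longrightarrow> I = J"
  using mset21_eqI mset_of_inject unfolding n_defs by metis

lemma n1_le: "n1 I \<le> 1"
  using mset_of[of I] by (simp add: is_odd_basis21_def n_defs)

lemma n_pos: "0 < n1 I + n2 I + n3 I"
proof (rule ccontr)
  assume "\<not> ?thesis"
  then have "mset_of I = {#}" by (intro mset21_eqI) (simp_all add: n_defs not_in_iff)
  then show False using mset_of[of I] by simp
qed

lemma mon_n [simp]: "mon (n1 I) (n2 I) (n3 I) = I"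
  by (rule mono21_eqI) (use n1_le[of I] n_pos[of I] in simp_all)

lemma mon_inj:
  assumes "a \<le> 1" "0 < a + b + c" "a' \<le> 1" "0 < a' + b' + c'"
  shows "mon a b c = mon a' b' c' \<longleftrightarrow> a = a' \<and> b = b' \<and> c = c'"
  using n_mon[OF assms(1,2)] n_mon[OF assms(3,4)] by metis

lemma deg_eq: "deg I = n1 I + n2 I + n3 I"
proof -
  have "mset_of I = mset21 (n1 I) (n2 I) (n3 I)"
    by (rule mset21_eqI) (auto simp: n_defs)
  then have "deg I = size (mset21 (n1 I) (n2 I) (n3 I))"
    by (simp add: deg_def)
  then show ?thesis
    by (simp add: mset21_def)
qed

lemma par_eq: "par I = n1 I"
proof -
  have "filter_mset is_odd (mset_of I) = replicate_mset (n1 I) W1"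
    by (rule mset21_eqI) (auto simp: is_odd_basis21_def n_defs)
  then show ?thesis
    by (simp add: par_def)
qed

text \<open>A sign arises only from two different odd basis vectors, and \<open>W1\<close> is the
  only odd one.\<close>

lemma koszul_21 [simp]: "koszul J (K :: basis21 mono) = 1"
proof -
  have "{(j, k). j \<in># mset_of J \<and> k \<in># mset_of K \<and> is_odd j \<and> is_odd k \<and> k < j} = {}"
    by (auto simp: is_odd_basis21_def)
  then show ?thesis
    unfolding koszul_def by (simp only: card.empty power_0)
qed

lemma UNIV_basis21: "UNIV = {W1, W2, W3}"
  using basis21.exhaust by auto

text \<open>\<open>binom\<close> multiplies over the support of \<open>I\<close> only. By the
  inclusion, a basis vector outside this support is missing from \<open>J\<close> too and
  contributes the factor 1.\<close>

lemma binom_21: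
  assumes "mset_of J \<subseteq># mset_of I"
  shows "binom I J = (n1 I choose n1 J) * (n2 I choose n2 J) * (n3 I choose n3 J)"
proof -
  have "binom I J = (\<Prod>i\<in>{W1, W2, W3}. count (mset_of I) i choose count (mset_of J) i)"
    unfolding binom_def
  proof (rule prod.mono_neutral_left)
    show "\<forall>i\<in>{W1, W2, W3} - set_mset (mset_of I). (count (mset_of I) i choose count (mset_of J) i) = 1"
      using assms by (auto simp: subseteq_mset_def not_in_iff simp del: count_eq_zero_iff) (metis le_zero_eq binomial_n_0 One_nat_def)+
    show "set_mset (mset_of I) \<subseteq> {W1, W2, W3}"
      by (metis UNIV_basis21 subset_UNIV)
  qed simp
  then show ?thesis
    by (simp add: n_defs)
qed

text \<open>The value 0 at exponents that give no monomial lets sums run over full boxes of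
  exponents: splittings with an empty factor then contribute nothing.\<close>

definition cf :: "(basis21 mono \<Rightarrow> complex) \<Rightarrow> nat \<Rightarrow> nat \<Rightarrow> nat \<Rightarrow> complex" where
  "cf F a b c = (if a \<le> 1 \<and> 0 < a + b + c then F (mon a b c) else 0)"

text \<open>A splitting is determined by the exponents of its left factor. Only the two corners
  \<open>(0, 0, 0)\<close> and \<open>(a, b, c)\<close> of the box come from no splitting, and there
  one of the two \<open>cf\<close> values is 0.\<close>

lemma conv_mon:
  assumes "a \<le> 1" "0 < a + b + c"
  shows "conv F G (mon a b c) = (\<Sum>i\<in>{..a}. \<Sum>j\<in>{0..b}. \<Sum>k\<in>{0..c}.
    of_nat ((a choose i) * (b choose j) * (c choose k)) * (cf F i j k * cf G (a - i) (b - j) (c - k)))"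
proof -
  let ?I = "mon a b c"
  let ?T = "{..a} \<times> {0..b} \<times> {0..c}"
  have cnt: "n1 J + n1 K = a \<and> n2 J + n2 K = b \<and> n3 J + n3 K = c" if "(J, K) \<in> splits ?I" for J K
  proof -
    have "mset_of J + mset_of K = mset21 a b c"
      using that assms by (simp add: splits_def mset_of_mon)
    then have "count (mset_of J + mset_of K) x = count (mset21 a b c) x" for x
      by simp
    then show ?thesis
      by (metis count_mset21 count_union n_defs)
  qed
  have "conv F G ?I = (\<Sum>(i, j, k)\<in>?T.
      of_nat ((a choose i) * (b choose j) * (c choose k)) * (cf F i j k * cf G (a - i) (b - j) (c - k)))"
    unfolding conv_def
  proof (rule sum.reindex_bij_witness_not_neutral[where S' = "{}" and T' = "{(0, 0, 0), (a, b, c)}"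
        and j = "\<lambda>(J, K). (n1 J, n2 J, n3 J)"
        and i = "\<lambda>(i, j, k). (mon i j k, mon (a - i) (b - j) (c - k))"], goal_cases)
    case (3 p)
    then obtain J K where p: "p = (J, K)" "(J, K) \<in> splits ?I"
      by (cases p) auto
    then have "a - n1 J = n1 K" "b - n2 J = n2 K" "c - n3 J = n3 K"
      using cnt[of J K] by auto
    then show ?case
      using p by simp
  next
    case (4 p)
    then obtain J K where p: "p = (J, K)" "(J, K) \<in> splits ?I"
      by (cases p) auto
    then show ?case
      using cnt[of J K] n_pos[of J] n_pos[of K] by auto
  next
    case (5 t)
    then show ?case
      using assms by (cases t) auto
  next
    case (6 t)
    then obtain i j k where t: "t = (i, j, k)" "i \<le> a" "j \<le> b" "k \<le> c"
      "(i, j, k) \<noteq> (0, 0, 0)" "(i, j, k) \<noteq> (a, b, c)"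
      by (cases t) auto
    have "mset21 i j k + mset21 (a - i) (b - j) (c - k) = mset21 a b c"
      by (rule mset21_eqI) (use t in auto)
    moreover have "0 < i + j + k" "0 < a - i + (b - j) + (c - k)" "i \<le> 1" "a - i \<le> 1"
      using t assms by auto
    ultimately show ?case
      using t(1) assms by (simp add: splits_def mset_of_mon)
  next
    case (8 t)
    then show ?case
      by (auto simp: cf_def)
  next
    case (9 p)
    then obtain J K where p: "p = (J, K)" "(J, K) \<in> splits ?I"
      by (cases p) auto
    note c = cnt[OF p(2)]
    have "mset_of J \<subseteq># mset_of ?I"
      using p(2) by (auto simp: splits_def dest: sym)
    then have b: "binom ?I J = (a choose n1 J) * (b choose n2 J) * (c choose n3 J)"
      using assms by (simp add: binom_21)
    have "a - n1 J = n1 K" "b - n2 J = n2 K" "c - n3 J = n3 K"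
      using c by auto
    moreover have "cf H (n1 L) (n2 L) (n3 L) = H L" for H L
      unfolding cf_def using n1_le[of L] n_pos[of L] by simp
    ultimately show ?case
      using p b by simp
  qed (use assms in auto)
  then show ?thesis
    by (simp add: sum.cartesian_product)
qed

text \<open>The formal variables \<open>t\<^sub>2\<close> (outer) and \<open>t\<^sub>3\<close> (inner) are dual to \<open>w\<^sub>2\<close> and \<open>w\<^sub>3\<close>. A functional is
  the series \<open>ser0 F + t\<^sub>1 ser1 F\<close>; the comultiplication has binomial coefficients, so that
  the dual basis consists of divided powers and the factorials below make the
  correspondence multiplicative. There is no unit, whence \<open>ser0 F\<close> has no constant term.\<close>

definition ser0 :: "(basis21 mono \<Rightarrow> complex) \<Rightarrow> complex fps fps" where
  "ser0 F = Abs_fps (\<lambda>b. Abs_fps (\<lambda>c. cf F 0 b c / (fact b * fact c)))"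

definition ser1 :: "(basis21 mono \<Rightarrow> complex) \<Rightarrow> complex fps fps" where
  "ser1 F = Abs_fps (\<lambda>b. Abs_fps (\<lambda>c. cf F 1 b c / (fact b * fact c)))"

definition mfact :: "basis21 mono \<Rightarrow> complex" where
  "mfact I = fact (n2 I) * fact (n3 I)"

text \<open>The inverse of passing to the pair \<open>ser0\<close>, \<open>ser1\<close>. The
  constant term of \<open>A\<close> is never read, because no monomial is empty; hence the condition
  \<open>A $ 0 $ 0 = 0\<close> in later statements.\<close>

definition unser :: "complex fps fps \<Rightarrow> complex fps fps \<Rightarrow> basis21 mono \<Rightarrow> complex" where
  "unser A B I = mfact I * (if n1 I = 0 then A $ n2 I $ n3 I else B $ n2 I $ n3 I)"

lemma mfact_nonzero [simp]: "mfact I \<noteq> 0"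
  by (simp add: mfact_def)

lemma fps2_eqI: "(\<And>i j. A $ i $ j = B $ i $ j) \<Longrightarrow> A = B"
  by (simp add: fps_eq_iff)

lemma fps2_mult_nth:
  fixes A B :: "'a::semiring_0 fps fps"
  shows "(A * B) $ b $ c = (\<Sum>i\<in>{0..b}. \<Sum>j\<in>{0..c}. A $ i $ j * B $ (b - i) $ (c - j))"
  by (simp add: fps_mult_nth fps_sum_nth)

lemma ser0_const [simp]: "ser0 F $ 0 $ 0 = 0"
  by (simp add: ser0_def cf_def)

lemma ser0_unser [simp]: "A $ 0 $ 0 = 0 \<Longrightarrow> ser0 (unser A B) = A"
  by (rule fps2_eqI) (auto simp: ser0_def unser_def cf_def mfact_def)

lemma ser1_unser [simp]: "ser1 (unser A B) = B"
  by (rule fps2_eqI) (auto simp: ser1_def unser_def cf_def mfact_def)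

lemma unser_ser [simp]: "unser (ser0 F) (ser1 F) = F"
proof
  fix I
  show "unser (ser0 F) (ser1 F) I = F I"
  proof (cases "n1 I = 0")
    case True
    then show ?thesis
      using n_pos[of I] mon_n[of I] by (simp add: unser_def ser0_def cf_def mfact_def del: mon_n)
  next
    case False
    then have "n1 I = 1"
      using n1_le[of I] by simp
    then show ?thesis
      using mon_n[of I] by (simp add: unser_def ser1_def cf_def mfact_def del: mon_n)
  qed
qed

lemma ser_eqI: "ser0 F = ser0 G \<Longrightarrow> ser1 F = ser1 G \<Longrightarrow> F = G"
  by (metis unser_ser)

lemma fact_choose: "k \<le> n \<Longrightarrow> of_nat (n choose k) / fact n = 1 / (fact k * (fact (n - k) :: complex))"
  by (simp add: binomial_fact)

lemma ser0_conv: "ser0 (conv F G) = ser0 F * ser0 G"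
proof (rule fps2_eqI)
  fix b c
  show "ser0 (conv F G) $ b $ c = (ser0 F * ser0 G) $ b $ c"
  proof (cases "b + c = 0")
    \<comment> \<open>Here \<open>conv_mon\<close> does not apply, as there is no empty monomial;
      both sides vanish because \<open>ser0\<close> has no constant term.\<close>
    case True
    then show ?thesis
      by (simp add: fps2_mult_nth)
  next
    case False
    have "ser0 (conv F G) $ b $ c = (\<Sum>j\<in>{0..b}. \<Sum>k\<in>{0..c}.
        (of_nat (b choose j) / fact b) * (of_nat (c choose k) / fact c) * (cf F 0 j k * cf G 0 (b - j) (c - k)))"
      using False by (simp add: ser0_def cf_def[of "conv F G"] conv_mon sum_divide_distrib)
    also have "\<dots> = (ser0 F * ser0 G) $ b $ c"
      unfolding fps2_mult_nth by (intro sum.cong refl) (simp add: fact_choose ser0_def)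
    finally show ?thesis .
  qed
qed

text \<open>The single \<open>t\<^sub>1\<close> belongs to exactly one of the two factors, and the
  even coefficient series pass it without a sign.\<close>

lemma ser1_conv: "ser1 (conv F G) = ser0 F * ser1 G + ser1 F * ser0 G"
proof (rule fps2_eqI)
  fix b c
  have "ser1 (conv F G) $ b $ c =
      (\<Sum>j\<in>{0..b}. \<Sum>k\<in>{0..c}.
        (of_nat (b choose j) / fact b) * (of_nat (c choose k) / fact c) * (cf F 0 j k * cf G 1 (b - j) (c - k)))
    + (\<Sum>j\<in>{0..b}. \<Sum>k\<in>{0..c}.
        (of_nat (b choose j) / fact b) * (of_nat (c choose k) / fact c) * (cf F 1 j k * cf G 0 (b - j) (c - k)))"
    by (simp add: ser1_def cf_def[of "conv F G"] conv_mon sum_divide_distrib add_divide_distrib)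
  also have "\<dots> = (ser0 F * ser1 G + ser1 F * ser0 G) $ b $ c"
    unfolding fps_add_nth fps2_mult_nth
    by (intro arg_cong2[where f = "(+)"] sum.cong refl) (simp_all add: fact_choose ser0_def ser1_def)
  finally show "ser1 (conv F G) $ b $ c = (ser0 F * ser1 G + ser1 F * ser0 G) $ b $ c" .
qed

abbreviation C2 :: "complex \<Rightarrow> complex fps fps" where
  "C2 c \<equiv> fps_const (fps_const c)"

lemma ser_add:
  "ser0 (\<lambda>I. F I + G I) = ser0 F + ser0 G" "ser1 (\<lambda>I. F I + G I) = ser1 F + ser1 G"
  by (rule fps2_eqI; simp add: ser0_def ser1_def cf_def add_divide_distrib)+

lemma ser_scaled:
  "ser0 (\<lambda>I. c * F I) = C2 c * ser0 F" "ser1 (\<lambda>I. c * F I) = C2 c * ser1 F"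
  by (rule fps2_eqI; simp add: ser0_def ser1_def cf_def)+

lemma ser_zero [simp]: "ser0 (\<lambda>I. 0) = 0" "ser1 (\<lambda>I. 0) = 0"
  by (rule fps2_eqI; simp add: ser0_def ser1_def cf_def)+

lemma ser_twist: "ser0 (twist 1 F) = ser0 F" "ser1 (twist 1 F) = - ser1 F"
  by (rule fps2_eqI; simp add: ser0_def ser1_def cf_def twist_def par_eq)+

lemma ser_minus: "ser0 (\<lambda>I. - F I) = - ser0 F" "ser1 (\<lambda>I. - F I) = - ser1 F"
  by (rule fps2_eqI; simp add: ser0_def ser1_def cf_def)+

definition mm :: "nat \<Rightarrow> nat \<Rightarrow> complex fps fps" where
  "mm b c = fps_X ^ b * fps_const fps_X ^ c"

lemma mm_nth: "mm b c $ i $ j = (if i = b \<and> j = c then 1 else 0)"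
  by (simp add: mm_def fps_const_power fps_X_power_nth)

lemma mm_mult: "mm b c * mm b' c' = mm (b + b') (c + c')"
  by (simp add: mm_def power_add mult_ac)

lemma ser_delta:
  "ser0 (delta J) = (if n1 J = 0 then C2 (1 / mfact J) * mm (n2 J) (n3 J) else 0)"
  "ser1 (delta J) = (if n1 J = 0 then 0 else C2 (1 / mfact J) * mm (n2 J) (n3 J))"
proof -
  have eq: "mon a b c = J \<longleftrightarrow> a = n1 J \<and> b = n2 J \<and> c = n3 J" if "a \<le> 1" "0 < a + b + c" for a b c
    using that by (metis mon_n n_mon)
  show "ser0 (delta J) = (if n1 J = 0 then C2 (1 / mfact J) * mm (n2 J) (n3 J) else 0)"
    using n_pos[of J]
    by (intro fps2_eqI) (auto simp: ser0_def cf_def delta_def eq mm_nth mfact_def)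
  show "ser1 (delta J) = (if n1 J = 0 then 0 else C2 (1 / mfact J) * mm (n2 J) (n3 J))"
    using n1_le[of J]
    by (intro fps2_eqI) (auto simp: ser1_def cf_def delta_def eq mm_nth mfact_def)
qed

text \<open>The functionals \<open>delta J\<close> are divided powers, so their product is a scalar
  multiple of the one with the added exponents. It is zero when \<open>t\<^sub>1\<close> occurs in
  both factors.\<close>

lemma conv_delta:
  "conv (delta J) (delta K) = (\<lambda>I. if n1 J + n1 K \<le> 1 then
    (let L = mon (n1 J + n1 K) (n2 J + n2 K) (n3 J + n3 K) in mfact L / (mfact J * mfact K) * delta L I) else 0)"
proof (cases "n1 J + n1 K \<le> 1")
  case True
  define L where "L = mon (n1 J + n1 K) (n2 J + n2 K) (n3 J + n3 K)"
  have L: "n1 L = n1 J + n1 K" "n2 L = n2 J + n2 K" "n3 L = n3 J + n3 K"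
    unfolding L_def by (rule n_mon; use True n_pos[of J] in linarith)+
  define e where "e = (\<lambda>J. C2 (1 / mfact J) * mm (n2 J) (n3 J))"
  have sd: "ser0 (delta I) = (if n1 I = 0 then e I else 0)" "ser1 (delta I) = (if n1 I = 0 then 0 else e I)" for I
    by (simp_all add: ser_delta e_def)
  have "C2 (1 / mfact J) * C2 (1 / mfact K) = C2 (mfact L / (mfact J * mfact K)) * C2 (1 / mfact L)"
    by simp
  then have "C2 (1 / mfact J) * C2 (1 / mfact K) * (mm (n2 J) (n3 J) * mm (n2 K) (n3 K))
      = C2 (mfact L / (mfact J * mfact K)) * C2 (1 / mfact L) * mm (n2 L) (n3 L)"
    by (simp only: mm_mult L(2,3))
  moreover define r where "r = mfact L / (mfact J * mfact K)"
  ultimately have c: "e J * e K = C2 r * e L"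
    unfolding e_def by (simp only: mult_ac)
  have "conv (delta J) (delta K) = (\<lambda>I. r * delta L I)"
    using True by (intro ser_eqI; simp add: ser0_conv ser1_conv ser_scaled sd c L(1))
  then show ?thesis
    using True by (simp add: L_def r_def Let_def)
next
  case False
  then have "n1 J \<noteq> 0" "n1 K \<noteq> 0"
    using n1_le[of J] n1_le[of K] by auto
  then have "conv (delta J) (delta K) = (\<lambda>I. 0)"
    by (intro ser_eqI) (simp_all add: ser0_conv ser1_conv ser_delta)
  then show ?thesis
    using False by simp
qed

definition "x1 = delta (mon 1 0 0)"
definition "x2 = delta (mon 0 1 0)"
definition "x3 = delta (mon 0 0 1)"

lemmas gen_defs = x1_def x2_def x3_def

lemma gen_eq_singleton:
  "delta (mono {#W1#}) = x1" "delta (mono {#W2#}) = x2" "delta (mono {#W3#}) = x3"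
  by (simp_all add: mon_def mset21_def gen_defs)

lemma ser_gen [simp]:
  "ser0 x1 = 0" "ser1 x1 = 1" "ser0 x2 = fps_X" "ser1 x2 = 0" "ser0 x3 = fps_const fps_X" "ser1 x3 = 0"
  by (simp_all add: gen_defs ser_delta mfact_def mm_def)

text \<open>The functionals on which \<open>dual X\<close> and \<open>dual Y\<close> agree form a subalgebra, and the coordinates
  generate the dual algebra topologically. The form of \<open>closed\<close> covers both coderivations and
  multiplicative maps.\<close>

lemma lin_eq_by_generators:
  assumes X: "lin X" and Y: "lin Y"
    and gen: "dual X x1 = dual Y x1" "dual X x2 = dual Y x2" "dual X x3 = dual Y x3"
    and closed: "\<And>F G. dual X F = dual Y F \<Longrightarrow> dual X G = dual Y G \<Longrightarrow> dual X (conv F G) = dual Y (conv F G)"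
  shows "X = Y"
proof (rule lin_eqI[OF X Y])
  fix J :: "basis21 mono"
  \<comment> \<open>The factorial quotient in \<open>conv_delta\<close> is nonzero and can be
    cancelled, so agreement on two factors gives agreement on the \<open>delta\<close> of the
    product monomial.\<close>
  have step: "dual X (delta (mon (a + i) (b + j) (c + k))) = dual Y (delta (mon (a + i) (b + j) (c + k)))"
    if "dual X (delta (mon a b c)) = dual Y (delta (mon a b c))"
      "dual X (delta (mon i j k)) = dual Y (delta (mon i j k))"
      "a + i \<le> 1" "0 < a + b + c" "0 < i + j + k" for a b c i j k
  proof -
    have "conv (delta (mon a b c)) (delta (mon i j k)) =
      (\<lambda>I. mfact (mon (a + i) (b + j) (c + k)) / (mfact (mon a b c) * mfact (mon i j k))
        * delta (mon (a + i) (b + j) (c + k)) I)"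
      using that(3-) by (simp add: conv_delta Let_def)
    then show ?thesis
      using closed[OF that(1,2)] by (simp only: dual_scaled) (simp add: fun_eq_iff)
  qed
  have "dual X (delta (mon a b c)) = dual Y (delta (mon a b c))" if "a \<le> 1" "0 < a + b + c" for a b c
    using that
  proof (induction "a + b + c" arbitrary: a b c)
    case (Suc n)
    show ?case
    proof (cases "n = 0")
      case True
      with Suc.hyps(2) have "(a, b, c) \<in> {(1, 0, 0), (0, 1, 0), (0, 0, 1)}"
        by auto
      then show ?thesis
        using gen by (auto simp: gen_defs)
    next
      case False
      \<comment> \<open>From degree 2 on, a monomial is a coordinate times a monomial of degree one
        less.\<close>
      consider "a = 1" | b' where "b = Suc b'" | c' where "c = Suc c'"
        using Suc.prems by (cases b; cases c) auto
      then show ?thesis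
      proof cases
        case 1
        then show ?thesis
          using step[of 0 b c 1 0 0] Suc False gen(1) by (simp add: gen_defs)
      next
        case (2 b')
        then show ?thesis
          using step[of a b' c 0 1 0] Suc False gen(2) by (simp add: gen_defs)
      next
        case (3 c')
        then show ?thesis
          using step[of a b c' 0 0 1] Suc False gen(3) by (simp add: gen_defs)
      qed
    qed
  qed simp
  from this[of "n1 J" "n2 J" "n3 J"] show "dual X (delta J) = dual Y (delta J)"
    using n1_le[of J] n_pos[of J] by simp
qed

subsection \<open>Odd coderivations as odd vector fields\<close>

definition d3 :: "complex fps fps \<Rightarrow> complex fps fps" where
  "d3 A = Abs_fps (\<lambda>n. fps_deriv (A $ n))"

lemma d3_add: "d3 (A + B) = d3 A + d3 B"
  by (simp add: d3_def fps_eq_iff distrib_left)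

lemma d3_mult: "d3 (A * B) = d3 A * B + A * d3 B"
proof (rule fps_ext)
  fix n
  show "d3 (A * B) $ n = (d3 A * B + A * d3 B) $ n"
    by (simp add: d3_def fps_mult_nth fps_deriv_sum sum.distrib add.commute)
qed

lemma d3_simps [simp]:
  "d3 0 = 0" "d3 1 = 0" "d3 (C2 c) = 0" "d3 fps_X = 0" "d3 (fps_const fps_X) = 1"
  by (rule fps2_eqI; simp add: d3_def)+

lemma fps_deriv_nth_nth: "fps_deriv A $ i $ j = of_nat (i + 1) * A $ (i + 1) $ j" for A :: "complex fps fps"
  by (simp only: fps_deriv_nth fps_of_nat[symmetric] fps_mult_left_const_nth)

text \<open>The transpose of \<open>D\<close> is the vector field \<open>f \<partial>\<^sub>1 +
  t\<^sub>1 (a \<partial>\<^sub>2 + b \<partial>\<^sub>3)\<close>. Its second summand kills the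
  \<open>ser1\<close> part because \<open>t\<^sub>1\<close> squares to zero.\<close>

definition represents ::
  "(basis21 sym \<Rightarrow> basis21 sym) \<Rightarrow> complex fps fps \<Rightarrow> complex fps fps \<Rightarrow> complex fps fps \<Rightarrow> bool" where
  "represents D f a b \<longleftrightarrow> (\<forall>F. ser0 (dual D F) = f * ser1 F \<and>
     ser1 (dual D F) = a * fps_deriv (ser0 F) + b * d3 (ser0 F))"

lemma finite_weight:
  assumes "0 < p" "0 < q"
  shows "finite {J. p * n2 J + q * n3 J \<le> (N :: nat)}"
proof (rule finite_subset)
  show "{J. p * n2 J + q * n3 J \<le> N} \<subseteq> (\<lambda>(a, b, c). mon a b c) ` ({..1} \<times> {..N} \<times> {..N})"
  proof
    fix J assume "J \<in> {J. p * n2 J + q * n3 J \<le> N}"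
    moreover have "n2 J \<le> p * n2 J" "n3 J \<le> q * n3 J"
      using assms by simp_all
    ultimately have "n2 J \<le> N" "n3 J \<le> N"
      by (simp_all only: mem_Collect_eq)
    then show "J \<in> (\<lambda>(a, b, c). mon a b c) ` ({..1} \<times> {..N} \<times> {..N})"
      using n1_le[of J] by (intro image_eqI[of _ _ "(n1 J, n2 J, n3 J)"]) auto
  qed
qed auto

text \<open>The condition on \<open>f\<close> keeps the image inside the series without constant
  term.\<close>

lemma ex_odd_coderivation:
  assumes "f $ 0 $ 0 = 0"
  shows "\<exists>D. coderivation 1 D \<and> represents D f a b"
proof -
  define T where "T = (\<lambda>F. unser (f * ser1 F) (a * fps_deriv (ser0 F) + b * d3 (ser0 F)))"
  have ser_T: "ser0 (T F) = f * ser1 F" "ser1 (T F) = a * fps_deriv (ser0 F) + b * d3 (ser0 F)" for F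
    using assms by (simp_all add: T_def)
  have add: "T (\<lambda>I. F I + G I) = (\<lambda>I. T F I + T G I)" for F G
    by (intro ser_eqI) (simp_all add: ser_T ser_add d3_add algebra_simps)
  have scale: "T (\<lambda>I. c * F I) = (\<lambda>I. c * T F I)" for c F
    by (intro ser_eqI) (simp_all add: ser_T ser_scaled d3_mult algebra_simps)
  have cont: "\<exists>S. finite S \<and> (\<forall>F. (\<forall>J\<in>S. F J = 0) \<longrightarrow> T F I = 0)" for I
  proof (intro exI conjI allI impI)
    \<comment> \<open>The extra 1 in the bound accounts for the derivatives, which read coefficients
      one degree higher.\<close>
    show "finite {J. 1 * n2 J + 1 * n3 J \<le> n2 I + n3 I + 1}"
      by (rule finite_weight) auto
    fix F :: "basis21 mono \<Rightarrow> complex"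
    assume F: "\<forall>J\<in>{J. 1 * n2 J + 1 * n3 J \<le> n2 I + n3 I + 1}. F J = 0"
    have "cf F i j k = 0" if "j + k \<le> n2 I + n3 I + 1" for i j k
      using F that by (auto simp: cf_def)
    then have z: "ser0 F $ j $ k = 0" "ser1 F $ j $ k = 0" if "j + k \<le> n2 I + n3 I + 1" for j k
      using that by (simp_all add: ser0_def ser1_def)
    have "(f * ser1 F) $ n2 I $ n3 I = 0" "(a * fps_deriv (ser0 F)) $ n2 I $ n3 I = 0"
      "(b * d3 (ser0 F)) $ n2 I $ n3 I = 0"
      unfolding fps2_mult_nth by (auto intro!: sum.neutral simp: z d3_def fps_deriv_nth_nth simp del: fps_deriv_nth) (simp_all add: z)
    then show "T F I = 0"
      by (simp add: T_def unser_def)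
  qed
  obtain D where D: "lin D" "dual D = T"
    using ex_dual[OF add scale cont] by blast
  have rep: "represents D f a b"
    by (simp add: represents_def D ser_T)
  have "coderivation 1 D"
    unfolding coderivation_iff homogeneous_iff D(2)
  proof (intro conjI allI)
    fix F G
    show "T (twist 1 F) = (\<lambda>I. (- 1) ^ 1 * twist 1 (T F) I)"
    proof -
      have "T (twist 1 F) = (\<lambda>I. - twist 1 (T F) I)"
        by (intro ser_eqI) (simp_all only: ser_T ser_twist ser_minus, simp_all)
      then show ?thesis
        by simp
    qed
    show "T (conv F G) = (\<lambda>I. conv (T F) G I + conv (twist 1 F) (T G) I)"
      by (intro ser_eqI)
        (simp_all only: ser_T ser_twist ser_add ser0_conv ser1_conv d3_mult fps_deriv_mult,
          simp_all add: algebra_simps)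
  qed (rule D)
  with rep show ?thesis
    by blast
qed

lemma fps2_neg_eq: "A = - A \<Longrightarrow> A = (0 :: complex fps fps)"
proof (rule fps2_eqI)
  fix i j assume "A = - A"
  then have "A $ i $ j = - (A $ i $ j)"
    by (metis fps_neg_nth)
  then show "A $ i $ j = 0 $ i $ j"
    by simp
qed

lemma represents_generators:
  assumes "represents D f a b" "f $ 0 $ 0 = 0"
  shows "dual D x1 = unser f 0" "dual D x2 = unser 0 a" "dual D x3 = unser 0 b"
  using assms by (auto intro!: ser_eqI simp: represents_def)

lemma coderivation_eqI:
  assumes D: "coderivation 1 D" and E: "coderivation 1 E"
    and gen: "dual D x1 = dual E x1" "dual D x2 = dual E x2" "dual D x3 = dual E x3"
  shows "D = E"
  using D E by (intro lin_eq_by_generators[OF _ _ gen]) (auto simp: coderivation_iff)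

text \<open>Oddness removes the \<open>t\<^sub>1\<close> part from the image of \<open>x1\<close>
  and leaves only the \<open>t\<^sub>1\<close> part in the images of \<open>x2\<close> and
  \<open>x3\<close>. The three remaining series define a vector field, whose coderivation agrees
  with \<open>D\<close> on the coordinates.\<close>

lemma coderivation_represents:
  assumes D: "coderivation 1 D"
  shows "\<exists>f a b. f $ 0 $ 0 = 0 \<and> represents D f a b"
proof -
  have tw: "dual D (twist 1 F) = (\<lambda>I. - twist 1 (dual D F) I)" for F
    using D by (simp add: coderivation_iff homogeneous_iff)
  have "twist 1 x1 = (\<lambda>I. - x1 I)" "twist 1 x2 = x2" "twist 1 x3 = x3"
    by (rule ser_eqI; simp only: ser_twist ser_minus ser_gen neg_equal_zero minus_zero)+
  then have "(\<lambda>I. - dual D x1 I) = (\<lambda>I. - twist 1 (dual D x1) I)"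
    "dual D x2 = (\<lambda>I. - twist 1 (dual D x2) I)" "dual D x3 = (\<lambda>I. - twist 1 (dual D x3) I)"
    using tw[of x1] tw[of x2] tw[of x3] by (simp_all only: dual_minus)
  then have "ser1 (\<lambda>I. - dual D x1 I) = ser1 (\<lambda>I. - twist 1 (dual D x1) I)"
    "ser0 (dual D x2) = ser0 (\<lambda>I. - twist 1 (dual D x2) I)"
    "ser0 (dual D x3) = ser0 (\<lambda>I. - twist 1 (dual D x3) I)"
    by simp_all
  then have "ser1 (dual D x1) = - ser1 (dual D x1)" "ser0 (dual D x2) = - ser0 (dual D x2)"
    "ser0 (dual D x3) = - ser0 (dual D x3)"
    by (simp_all only: ser_minus ser_twist minus_minus)
  then have z: "ser1 (dual D x1) = 0" "ser0 (dual D x2) = 0" "ser0 (dual D x3) = 0"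
    using fps2_neg_eq by metis+
  define f a b where "f = ser0 (dual D x1)" and "a = ser1 (dual D x2)" and "b = ser1 (dual D x3)"
  have f: "f $ 0 $ 0 = 0"
    by (simp add: f_def)
  obtain E where E: "coderivation 1 E" "represents E f a b"
    using ex_odd_coderivation[OF f] by blast
  have gen: "dual D x1 = dual E x1" "dual D x2 = dual E x2" "dual D x3 = dual E x3"
    unfolding represents_generators[OF E(2) f]
    by (rule ser_eqI; simp add: f; simp add: f_def a_def b_def z)+
  have "D = E"
    by (rule coderivation_eqI[OF D E(1) gen])
  with E f show ?thesis
    by blast
qed

text \<open>Applying the field twice to \<open>t\<^sub>2\<close> and \<open>t\<^sub>3\<close> gives
  \<open>f * a\<close> and \<open>f * b\<close>, and the ring of power series has no zero
  divisors.\<close>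

lemma L_infinity_represents:
  assumes "d \<in> L_infinity" "represents d f a b"
  shows "f = 0 \<or> (a = 0 \<and> b = 0)"
proof -
  have "lin d" "d \<circ> d = (\<lambda>v. 0)"
    using assms by (auto simp: L_infinity_iff coderivation_def)
  then have "dual d (dual d F) = (\<lambda>I. 0)" for F
    using dual_comp[of d d F] by (simp add: dual_def fun_eq_iff)
  then have "ser0 (dual d (dual d F)) = 0" for F
    by simp
  from this[of x2] this[of x3] have "f * a = 0" "f * b = 0"
    using assms(2) by (simp_all add: represents_def)
  then show ?thesis
    by auto
qed

lemma represents_L_infinity:
  assumes "coderivation 1 d" "represents d f a b" "f = 0 \<or> (a = 0 \<and> b = 0)"
  shows "d \<in> L_infinity"
proof -
  have d: "lin d"
    using assms(1) by (simp add: coderivation_def)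
  have "dual d (dual d F) = (\<lambda>I. 0)" for F
    using assms(2,3) by (intro ser_eqI) (auto simp: represents_def)
  moreover have "lin (\<lambda>v :: basis21 sym. 0 :: basis21 sym)"
    unfolding lin_iff by simp
  ultimately have "d \<circ> d = (\<lambda>v. 0)"
    by (intro lin_eqI lin_comp d) (simp_all only: dual_comp d, simp add: dual_def[abs_def])
  then show ?thesis
    using assms(1) by (simp add: L_infinity_iff fun_eq_iff)
qed

section \<open>Corestrictions, leading terms and the two normal forms\<close>

lemma lookup_proj_space:
  "Poly_Mapping.lookup (proj_space v) i = Poly_Mapping.lookup v (mono {#i#})"
proof -
  have "ev (delta i) (if deg I = 1 then bas (THE i. mset_of I = {#i#}) else 0) = delta (mono {#i#}) I" for I
  proof (cases "deg I = 1")
    case True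
    then obtain k where k: "mset_of I = {#k#}"
      by (metis deg_def size_1_singleton_mset)
    have "I = mono {#i#} \<longleftrightarrow> k = i"
    proof -
      have "I = mono {#k#}"
        by (metis k mset_of_inverse)
      moreover have "mset_of (mono {#i#}) = {#i#}"
        by (rule mono_inverse) auto
      ultimately show ?thesis
        using k by auto
    qed
    with True show ?thesis
      by (simp add: k delta_def lookup_single when_def)
  next
    case False
    have "mset_of (mono {#i#}) = {#i#}"
      by (rule mono_inverse) auto
    with False have "I \<noteq> mono {#i#}"
      by (auto simp: deg_def)
    with False show ?thesis
      by (simp add: delta_def)
  qed
  then have "ev (delta i) (proj_space v) = ev (delta (mono {#i#})) v"
    by (simp only: proj_space_def ev_extend)
  then show ?thesis
    by simp
qed

lemma lookup_corestriction:
  "Poly_Mapping.lookup (corestriction D (bas I)) i = dual D (delta (mono {#i#})) I"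
  by (simp add: corestriction_def lookup_proj_space dual_def)

lemma lin_corestriction: "lin D \<Longrightarrow> lin (corestriction D)"
  unfolding corestriction_def proj_space_def by (intro lin_comp lin_extend)

text \<open>The components of the corestriction are the images of the three coordinates, and these
  determine a coderivation. This is the uniqueness that the definite description in
  \<open>coder_of\<close> requires.\<close>

lemma coder_of_eqI:
  assumes "coderivation 1 D" "lin \<phi>"
    and "\<And>I. Poly_Mapping.lookup (\<phi> (bas I)) W1 = dual D x1 I"
    and "\<And>I. Poly_Mapping.lookup (\<phi> (bas I)) W2 = dual D x2 I"
    and "\<And>I. Poly_Mapping.lookup (\<phi> (bas I)) W3 = dual D x3 I"
  shows "coder_of 1 \<phi> = D"
  unfolding coder_of_def
proof (rule the_equality)
  have D: "lin D"
    using assms(1) by (simp add: coderivation_def)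
  have "corestriction D (bas I) = \<phi> (bas I)" for I
  proof (rule poly_mapping_eqI)
    fix i show "Poly_Mapping.lookup (corestriction D (bas I)) i = Poly_Mapping.lookup (\<phi> (bas I)) i"
      using assms(3-5) by (cases i) (simp_all add: lookup_corestriction gen_eq_singleton)
  qed
  then have "corestriction D = \<phi>"
    using lin_eq_extend[OF lin_corestriction[OF D]] lin_eq_extend[OF assms(2)] by simp
  with assms(1) show "coderivation 1 D \<and> corestriction D = \<phi>"
    by simp
  fix E assume E: "coderivation 1 E \<and> corestriction E = \<phi>"
  have "dual E (delta (mono {#i#})) = dual D (delta (mono {#i#}))" for i
    using E \<open>corestriction D = \<phi>\<close> by (metis lookup_corestriction ext)
  then show "E = D"
    using E assms(1) by (intro coderivation_eqI) (simp_all flip: gen_eq_singleton)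
qed

lemma lookup_L_term:
  assumes "lin d"
  shows "Poly_Mapping.lookup (L_term n d (bas I)) i = (if deg I = n then dual d (delta (mono {#i#})) I else 0)"
  using lin_zero[OF lin_corestriction[OF assms]]
  by (simp add: L_term_def part_def lookup_corestriction)

lemma represents_coeff:
  assumes "represents D f a b" "f $ 0 $ 0 = 0"
  shows "f $ 1 $ 0 = dual D x1 (mon 0 1 0)" "f $ 0 $ 1 = dual D x1 (mon 0 0 1)"
    "a $ 0 $ 0 = dual D x2 (mon 1 0 0)" "b $ 0 $ 0 = dual D x3 (mon 1 0 0)"
  by (simp_all add: represents_generators[OF assms] unser_def mfact_def)

text \<open>Degree counts \<open>t\<^sub>1\<close> as well: degree one keeps the linear terms of an
  even series but only the constant term of a coefficient of \<open>t\<^sub>1\<close>.\<close>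

lemma unser_deg_1:
  "(if deg I = 1 then unser f 0 I else 0) = unser (Abs_fps (\<lambda>i. Abs_fps (\<lambda>j. if i + j = 1 then f $ i $ j else 0))) 0 I"
  "(if deg I = 1 then unser 0 a I else 0) = unser 0 (C2 (a $ 0 $ 0)) I"
proof -
  show "(if deg I = 1 then unser f 0 I else 0) = unser (Abs_fps (\<lambda>i. Abs_fps (\<lambda>j. if i + j = 1 then f $ i $ j else 0))) 0 I"
    by (simp add: unser_def deg_eq)
  consider "n1 I = 0" | "n1 I = 1"
    using n1_le[of I] by linarith
  then show "(if deg I = 1 then unser 0 a I else 0) = unser 0 (C2 (a $ 0 $ 0)) I"
    by cases (auto simp: unser_def deg_eq)
qed

lemma leading_term:
  assumes d: "coderivation 1 d" and rep: "represents d f a b" "f $ 0 $ 0 = 0"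
  shows "\<exists>f'. represents (coder_of 1 (L_term 1 d)) f' (C2 (a $ 0 $ 0)) (C2 (b $ 0 $ 0)) \<and>
    coderivation 1 (coder_of 1 (L_term 1 d)) \<and>
    (\<forall>i j. f' $ i $ j = (if i + j = 1 then f $ i $ j else 0))"
proof -
  define f' where "f' = Abs_fps (\<lambda>i. Abs_fps (\<lambda>j. if i + j = 1 then f $ i $ j else 0))"
  have f': "f' $ 0 $ 0 = 0"
    by (simp add: f'_def)
  obtain D where D: "coderivation 1 D" "represents D f' (C2 (a $ 0 $ 0)) (C2 (b $ 0 $ 0))"
    using ex_odd_coderivation[OF f'] by blast
  have lin: "lin d"
    using d by (simp add: coderivation_def)
  have linL: "lin (L_term 1 d)"
    unfolding L_term_def part_def by (intro lin_comp lin_corestriction lin lin_extend)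
  have "coder_of 1 (L_term 1 d) = D"
  proof (rule coder_of_eqI[OF D(1) linL])
    fix I
    show "Poly_Mapping.lookup (L_term 1 d (bas I)) W1 = dual D x1 I"
      "Poly_Mapping.lookup (L_term 1 d (bas I)) W2 = dual D x2 I"
      "Poly_Mapping.lookup (L_term 1 d (bas I)) W3 = dual D x3 I"
      unfolding lookup_L_term[OF lin] gen_eq_singleton represents_generators[OF rep]
        represents_generators[OF D(2) f'] f'_def by (rule unser_deg_1)+
  qed
  with D show ?thesis
    by (auto simp: f'_def)
qed

text \<open>By oddness the matrix of \<open>d\<^sub>1\<close> has only four possibly nonzero
  entries, namely those from \<open>w\<^sub>2\<close> and \<open>w\<^sub>3\<close> to
  \<open>w\<^sub>1\<close> and those from \<open>w\<^sub>1\<close> to \<open>w\<^sub>2\<close> and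
  \<open>w\<^sub>3\<close>.\<close>

lemma L_term_nonzero:
  assumes d: "coderivation 1 d" and rep: "represents d f a b" "f $ 0 $ 0 = 0"
  shows "L_term 1 d \<noteq> (\<lambda>v. 0) \<longleftrightarrow>
    f $ 1 $ 0 \<noteq> 0 \<or> f $ 0 $ 1 \<noteq> 0 \<or> a $ 0 $ 0 \<noteq> 0 \<or> b $ 0 $ 0 \<noteq> 0"
proof -
  have lin: "lin d"
    using d by (simp add: coderivation_def)
  have linL: "lin (L_term 1 d)"
    unfolding L_term_def part_def by (intro lin_comp lin_corestriction lin lin_extend)
  note L = lookup_L_term[OF lin, of 1]
  show ?thesis
  proof
    assume "f $ 1 $ 0 \<noteq> 0 \<or> f $ 0 $ 1 \<noteq> 0 \<or> a $ 0 $ 0 \<noteq> 0 \<or> b $ 0 $ 0 \<noteq> 0"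
    then have "dual d x1 (mon 0 1 0) \<noteq> 0 \<or> dual d x1 (mon 0 0 1) \<noteq> 0 \<or>
        dual d x2 (mon 1 0 0) \<noteq> 0 \<or> dual d x3 (mon 1 0 0) \<noteq> 0"
      by (simp only: represents_coeff[OF rep])
    moreover have "Poly_Mapping.lookup (L_term 1 d (bas (mon 0 1 0))) W1 = dual d x1 (mon 0 1 0)"
      "Poly_Mapping.lookup (L_term 1 d (bas (mon 0 0 1))) W1 = dual d x1 (mon 0 0 1)"
      "Poly_Mapping.lookup (L_term 1 d (bas (mon 1 0 0))) W2 = dual d x2 (mon 1 0 0)"
      "Poly_Mapping.lookup (L_term 1 d (bas (mon 1 0 0))) W3 = dual d x3 (mon 1 0 0)"
      unfolding L by (simp_all add: gen_eq_singleton deg_eq)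
    ultimately have "\<exists>I i. Poly_Mapping.lookup (L_term 1 d (bas I)) i \<noteq> 0"
      by metis
    then show "L_term 1 d \<noteq> (\<lambda>v. 0)"
      by (metis lookup_zero)
  next
    assume ne: "L_term 1 d \<noteq> (\<lambda>v. 0)"
    show "f $ 1 $ 0 \<noteq> 0 \<or> f $ 0 $ 1 \<noteq> 0 \<or> a $ 0 $ 0 \<noteq> 0 \<or> b $ 0 $ 0 \<noteq> 0"
    proof (rule ccontr)
      assume z: "\<not> ?thesis"
      have "L_term 1 d (bas I) = 0" for I
      proof (rule poly_mapping_eqI)
        fix i
        have "f $ j $ k = 0" if "j + k = 1" for j k
          using that z by (cases j) auto
        then have "(if deg I = 1 then unser f 0 I else 0) = 0"
          by (simp add: unser_def deg_eq)
        moreover have "(if deg I = 1 then unser 0 a I else 0) = 0" "(if deg I = 1 then unser 0 b I else 0) = 0"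
          using z by (simp_all only: unser_deg_1) (simp_all add: unser_def)
        ultimately show "Poly_Mapping.lookup (L_term 1 d (bas I)) i = Poly_Mapping.lookup 0 i"
          unfolding L by (cases i) (simp_all only: gen_eq_singleton represents_generators[OF rep] lookup_zero)
      qed
      then have "L_term 1 d = extend (\<lambda>x. 0)"
        using lin_eq_extend[OF linL] by simp
      also have "\<dots> = (\<lambda>v. 0)"
        by (simp add: extend_def fun_eq_iff)
      finally show False
        using ne by blast
    qed
  qed
qed

lemma lookup_unit_map:
  "Poly_Mapping.lookup (unit_map i j (bas I)) k = (if k = j then delta (mono {#i#}) I else 0)"
proof -
  have "mset_of (mono {#i#}) = {#i#}"
    by (rule mono_inverse) auto
  then have "mset_of I = {#i#} \<longleftrightarrow> I = mono {#i#}"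
    by (metis mset_of_inverse)
  then show ?thesis
    by (auto simp: unit_map_def delta_def lookup_single when_def)
qed

lemma unser_gen: "unser 0 1 = x1" "unser fps_X 0 = x2" "unser (fps_const fps_X) 0 = x3" "unser 0 0 = (\<lambda>I. 0)"
  by (rule ser_eqI; simp)+

text \<open>Transposition reverses arrows: the map from \<open>w\<^sub>1\<close> to
  \<open>w\<^sub>2\<close> sends the coordinate \<open>t\<^sub>2\<close> to
  \<open>t\<^sub>1\<close>, so it is the field \<open>t\<^sub>1 \<partial>\<^sub>2\<close>.\<close>

lemma psi_100_2: "coderivation 1 psi_100_2" "represents psi_100_2 0 1 0"
proof -
  obtain D where D: "coderivation 1 D" "represents D 0 1 0"
    using ex_odd_coderivation[of 0 1 0] by auto
  have "psi_100_2 = D"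
    unfolding psi_100_2_def
    by (rule coder_of_eqI[OF D(1)]; (simp add: unit_map_def lin_extend; fail)?)
      (simp_all add: lookup_unit_map represents_generators[OF D(2)] gen_eq_singleton unser_gen)
  with D show "coderivation 1 psi_100_2" "represents psi_100_2 0 1 0"
    by simp_all
qed

lemma psi_010_1: "coderivation 1 psi_010_1" "represents psi_010_1 fps_X 0 0"
proof -
  obtain D where D: "coderivation 1 D" "represents D fps_X 0 0"
    using ex_odd_coderivation[of fps_X 0 0] by auto
  have "psi_010_1 = D"
    unfolding psi_010_1_def
    by (rule coder_of_eqI[OF D(1)]; (simp add: unit_map_def lin_extend; fail)?)
      (simp_all add: lookup_unit_map represents_generators[OF D(2)] gen_eq_singleton unser_gen)
  with D show "coderivation 1 psi_010_1" "represents psi_010_1 fps_X 0 0"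
    by simp_all
qed

subsection \<open>Automorphisms\<close>

text \<open>In a nonzero kernel vector, a basis element of maximal weight would keep a nonzero
  coefficient in the image, since no other term can reach it. For surjectivity, induction on the
  weight solves for \<open>bas x\<close>, because the lower terms of \<open>g (bas x)\<close> are
  already in the range.\<close>

lemma triangular_bij:
  fixes g :: "('x \<Rightarrow>\<^sub>0 complex) \<Rightarrow> ('x \<Rightarrow>\<^sub>0 complex)" and wt :: "'x \<Rightarrow> nat"
  assumes lin: "lin g"
    and diag: "\<And>x. Poly_Mapping.lookup (g (bas x)) x \<noteq> 0"
    and lower: "\<And>x y. Poly_Mapping.lookup (g (bas x)) y \<noteq> 0 \<Longrightarrow> y \<noteq> x \<Longrightarrow> wt y < wt x"
  shows "bij g"
proof (rule bijI)
  have ker: "v = 0" if v: "g v = 0" for v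
  proof (rule ccontr)
    assume "v \<noteq> 0"
    then have ne: "Poly_Mapping.keys v \<noteq> {}"
      by simp
    define m where "m = Max (wt ` Poly_Mapping.keys v)"
    have fin: "finite (wt ` Poly_Mapping.keys v)"
      by simp
    have "m \<in> wt ` Poly_Mapping.keys v"
      unfolding m_def using ne by (intro Max_in fin) simp
    then obtain x where x: "x \<in> Poly_Mapping.keys v" "wt x = m"
      by blast
    have "Poly_Mapping.lookup (g v) x = ev (\<lambda>y. Poly_Mapping.lookup (g (bas y)) x) v"
      using ev_lin[OF lin, of "delta x" v] by (simp add: dual_def[abs_def])
    also have "\<dots> = (\<Sum>y\<in>Poly_Mapping.keys v.
        if y = x then Poly_Mapping.lookup v x * Poly_Mapping.lookup (g (bas x)) x else 0)"
      unfolding ev_def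
    proof (intro sum.cong refl)
      fix y assume y: "y \<in> Poly_Mapping.keys v"
      then have "wt y \<le> wt x"
        using fin x(2) by (simp add: m_def)
      then have "y \<noteq> x \<Longrightarrow> Poly_Mapping.lookup (g (bas y)) x = 0"
        using lower[of y x] by (metis leD)
      then show "Poly_Mapping.lookup v y * Poly_Mapping.lookup (g (bas y)) x =
          (if y = x then Poly_Mapping.lookup v x * Poly_Mapping.lookup (g (bas x)) x else 0)"
        by simp
    qed
    also have "\<dots> \<noteq> 0"
      using x(1) diag[of x] by (simp add: in_keys_iff)
    finally show False
      using v by simp
  qed
  show "inj g"
  proof (rule injI)
    fix u v assume "g u = g v"
    moreover have "g (u - v) + g v = g u"
      using lin_add[OF lin, of "u - v" v] by simp
    ultimately have "g (u - v) = 0"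
      by simp
    then show "u = v"
      using ker[of "u - v"] by simp
  qed
  have range_add: "u + v \<in> range g" if "u \<in> range g" "v \<in> range g" for u v
    using that by (auto simp: lin_add[OF lin, symmetric])
  have range_smult: "smult c v \<in> range g" if "v \<in> range g" for c v
    using that by (auto simp: lin_smult[OF lin, symmetric])
  have range_sum: "(\<Sum>i\<in>A. u i) \<in> range g" if "\<And>i. i \<in> A \<Longrightarrow> u i \<in> range g" for A :: "'x set" and u
    using that
    by (induction A rule: infinite_finite_induct)
      (auto intro!: range_add intro: range_eqI[of _ _ 0] simp: lin_zero[OF lin])
  have bas_range: "bas x \<in> range g" for x
  proof (induction "wt x" arbitrary: x rule: less_induct)
    case less
    define c where "c = Poly_Mapping.lookup (g (bas x)) x"
    let ?K = "Poly_Mapping.keys (g (bas x)) - {x}"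
    define r where "r = (\<Sum>y\<in>?K. smult (Poly_Mapping.lookup (g (bas x)) y) (bas y))"
    have "x \<in> Poly_Mapping.keys (g (bas x))"
      using diag[of x] by (simp add: in_keys_iff)
    then have "g (bas x) = smult c (bas x) + r"
      by (subst bas_expansion) (simp add: r_def c_def sum.remove)
    then have "g (bas x) + smult (- 1) r = smult c (bas x)"
      by simp
    then have "bas x = smult (1 / c) (g (bas x) + smult (- 1) r)"
      using diag[of x] by (simp only: free_vs.scale_scale) (simp add: c_def)
    moreover have "r \<in> range g"
      unfolding r_def using less lower by (intro range_sum range_smult) (auto simp: in_keys_iff)
    ultimately show ?case
      by (metis range_add range_smult rangeI)
  qed
  show "surj g"
  proof -
    have "v \<in> range g" for v
      by (subst bas_expansion[of v]) (intro range_sum range_smult bas_range)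
    then show ?thesis
      by auto
  qed
qed

text \<open>The lowest term of \<open>A\<close> with respect to the weights \<open>p\<close> of \<open>t\<^sub>2\<close> and \<open>q\<close> of \<open>t\<^sub>3\<close> is
  \<open>\<kappa> t\<^sub>2\<^sup>b t\<^sub>3\<^sup>c\<close>, all others having larger weight.\<close>

definition leading :: "nat \<Rightarrow> nat \<Rightarrow> complex \<Rightarrow> nat \<Rightarrow> nat \<Rightarrow> complex fps fps \<Rightarrow> bool" where
  "leading p q \<kappa> b c A \<longleftrightarrow>
    (\<forall>i j. p * i + q * j \<le> p * b + q * c \<longrightarrow> A $ i $ j = (if i = b \<and> j = c then \<kappa> else 0))"

text \<open>If one factor of a summand exceeds its leading weight, the other lies below its own,
  where it vanishes. Only the product of the two leading terms survives.\<close>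

lemma leading_mult:
  assumes A: "leading p q \<kappa> b c A" and B: "leading p q \<kappa>' b' c' B"
  shows "leading p q (\<kappa> * \<kappa>') (b + b') (c + c') (A * B)"
  unfolding leading_def
proof (intro allI impI)
  fix i j assume le: "p * i + q * j \<le> p * (b + b') + q * (c + c')"
  have "(A * B) $ i $ j = (\<Sum>r\<in>{0..i}. \<Sum>s\<in>{0..j}.
      if r = b \<and> s = c then (if i = b + b' \<and> j = c + c' then \<kappa> * \<kappa>' else 0) else 0)"
    unfolding fps2_mult_nth
  proof (intro sum.cong refl)
    fix r s assume rs: "r \<in> {0..i}" "s \<in> {0..j}"
    obtain i' j' where "i = r + i'" "j = s + j'"
      using rs by (auto simp: le_iff_add)
    then have w: "p * (i - r) + q * (j - s) + (p * r + q * s) = p * i + q * j"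
      by (simp add: distrib_left)
    have iff: "i - r = b' \<and> j - s = c' \<longleftrightarrow> i = r + b' \<and> j = s + c'"
      using rs by auto
    consider (le) "p * r + q * s \<le> p * b + q * c" "p * (i - r) + q * (j - s) \<le> p * b' + q * c'"
      | (gt1) "p * r + q * s > p * b + q * c" | (gt2) "p * (i - r) + q * (j - s) > p * b' + q * c'"
      by linarith
    then show "A $ r $ s * B $ (i - r) $ (j - s) =
        (if r = b \<and> s = c then (if i = b + b' \<and> j = c + c' then \<kappa> * \<kappa>' else 0) else 0)"
    proof cases
      case le
      then show ?thesis
        using A B iff by (auto simp: leading_def)
    next
      case gt1
      then have "p * (i - r) + q * (j - s) < p * b' + q * c'"
        using w le by (simp add: distrib_left)
      then have "B $ (i - r) $ (j - s) = 0"
        using B by (auto simp: leading_def)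
      moreover have "\<not> (r = b \<and> s = c)"
        using gt1 by auto
      ultimately show ?thesis
        by auto
    next
      case gt2
      then have "p * r + q * s < p * b + q * c"
        using w le by (simp add: distrib_left)
      then have "A $ r $ s = 0" "\<not> (r = b \<and> s = c)"
        using A by (auto simp: leading_def)
      then show ?thesis
        by auto
    qed
  qed
  also have "\<dots> = (if i = b + b' \<and> j = c + c' then \<kappa> * \<kappa>' else 0)"
  proof -
    have "(\<Sum>r\<in>{0..i}. \<Sum>s\<in>{0..j}. if r = b \<and> s = c then z else 0) = (if b \<le> i \<and> c \<le> j then z else 0)"
      for z :: complex
    proof -
      have "(\<Sum>s\<in>{0..j}. if r = b \<and> s = c then z else 0) = (if r = b then (if c \<le> j then z else 0) else 0)" for r
        by (cases "r = b") simp_all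
      then show ?thesis
        by simp
    qed
    then show ?thesis
      by auto
  qed
  finally show "(A * B) $ i $ j = (if i = b + b' \<and> j = c + c' then \<kappa> * \<kappa>' else 0)" .
qed

lemma leading_power:
  assumes "0 < p" "0 < q" and A: "leading p q \<kappa> b c A"
  shows "leading p q (\<kappa> ^ n) (n * b) (n * c) (A ^ n)"
proof (induction n)
  case 0
  show ?case
    using assms(1,2) by (auto simp: leading_def)
next
  case (Suc n)
  show ?case
    using leading_mult[OF A Suc] by simp
qed

text \<open>The substitution of \<open>t\<^sub>1 h\<close>, \<open>u2\<close>, \<open>u3\<close> for
  the coordinates keeps the leading exponents of every monomial, so \<open>g\<close> is triangular
  for the weight with nonzero diagonal. The free choice of \<open>p\<close> and \<open>q\<close>
  admits linear parts that are triangular but not diagonal.\<close>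

lemma automorphism_of_coordinates:
  assumes pq: "0 < p" "0 < q" and nz: "\<eta> \<noteq> 0" "\<kappa>2 \<noteq> 0" "\<kappa>3 \<noteq> 0"
    and h: "leading p q \<eta> 0 0 h" and u2: "leading p q \<kappa>2 1 0 u2" and u3: "leading p q \<kappa>3 0 1 u3"
  shows "\<exists>g. coalgebra_automorphism g \<and>
    dual g x1 = unser 0 h \<and> dual g x2 = unser u2 0 \<and> dual g x3 = unser u3 0"
proof -
  define wt where "wt = (\<lambda>J. p * n2 J + q * n3 J)"
  define U where "U b c = u2 ^ b * u3 ^ c" for b c
  have lead_U: "leading p q (\<kappa>2 ^ b * \<kappa>3 ^ c) b c (U b c)" for b c
    unfolding U_def
    using leading_mult[OF leading_power[OF pq u2, of b] leading_power[OF pq u3, of c]] by simp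
  have lead_hU: "leading p q (\<eta> * (\<kappa>2 ^ b * \<kappa>3 ^ c)) b c (h * U b c)" for b c
    using leading_mult[OF h lead_U[of b c]] by simp
  have U_mult: "U (b + b') (c + c') = U b c * U b' c'" for b b' c c'
    by (simp add: U_def power_add mult_ac)
  define V0 V1 where "V0 J = (if n1 J = 0 then U (n2 J) (n3 J) else 0)"
    and "V1 J = (if n1 J = 0 then 0 else h * U (n2 J) (n3 J))" for J
  have V0: "V0 J $ 0 $ 0 = 0" for J
    using n_pos[of J] pq lead_U[of "n2 J" "n3 J"] by (auto simp: V0_def leading_def)
  \<comment> \<open>The image of \<open>delta J\<close>; the factor comes from
    \<open>delta J\<close> being a divided power.\<close>
  define P where "P J = (\<lambda>I. 1 / mfact J * unser (V0 J) (V1 J) I)" for J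
  have P_nz: "n1 I = n1 J \<and> (I = J \<or> wt J < wt I)" if "P J I \<noteq> 0" for I J
  proof -
    have *: "unser (V0 J) (V1 J) I \<noteq> 0"
      using that by (auto simp: P_def)
    then have eq: "n1 I = n1 J"
      using n1_le[of I] n1_le[of J] by (auto simp: unser_def V0_def V1_def split: if_splits)
    moreover have "I = J" if "\<not> wt J < wt I"
    proof (rule mono21_eqI[OF eq])
      have le: "p * n2 I + q * n3 I \<le> p * n2 J + q * n3 J"
        using that by (simp add: wt_def)
      show "n2 I = n2 J" "n3 I = n3 J"
        using * le lead_U[of "n2 J" "n3 J"] lead_hU[of "n2 J" "n3 J"]
        by (auto simp: unser_def V0_def V1_def leading_def split: if_splits)
    qed
    ultimately show ?thesis
      by blast
  qed
  have P_diag: "P J J \<noteq> 0" for J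
    using nz lead_U[of "n2 J" "n3 J"] lead_hU[of "n2 J" "n3 J"]
    by (simp add: P_def unser_def V0_def V1_def leading_def)
  have ser_P: "ser0 (P J) = C2 (1 / mfact J) * V0 J" "ser1 (P J) = C2 (1 / mfact J) * V1 J" for J
    unfolding P_def ser_scaled by (simp_all add: V0)
  \<comment> \<open>Restricting to \<open>wt J \<le> wt I\<close> makes the sum finite and loses
    nothing, since by \<open>P_nz\<close> the other values of \<open>P J I\<close> are zero.\<close>
  define T where "T F I = (\<Sum>J | wt J \<le> wt I. F J * P J I)" for F I
  have fin: "finite {J. wt J \<le> wt I}" for I
    unfolding wt_def by (rule finite_weight[OF pq])
  have "\<exists>g. lin g \<and> dual g = T"
  proof (rule ex_dual)
    show "T (\<lambda>y. F y + G y) = (\<lambda>x. T F x + T G x)" for F G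
      by (simp add: T_def fun_eq_iff distrib_right sum.distrib)
    show "T (\<lambda>y. c * F y) = (\<lambda>x. c * T F x)" for c F
      by (simp add: T_def fun_eq_iff sum_distrib_left mult.assoc)
    show "\<exists>S. finite S \<and> (\<forall>F. (\<forall>y\<in>S. F y = 0) \<longrightarrow> T F x = 0)" for x
      using fin[of x] by (auto simp: T_def intro!: exI[of _ "{J. wt J \<le> wt x}"])
  qed
  then obtain g where g: "lin g" "dual g = T"
    by blast
  have g_delta: "dual g (delta J) = P J" for J
  proof
    fix I
    have "dual g (delta J) I = (\<Sum>K | wt K \<le> wt I. if K = J then P J I else 0)"
      by (simp add: g(2) T_def delta_def if_distrib[of "\<lambda>x. x * _"] cong: if_cong)
    also have "\<dots> = P J I"
    proof (cases "P J I = 0")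
      case False
      then show ?thesis
        using fin[of I] P_nz[of J I] by auto
    next
      case True
      then show ?thesis
        by (subst True, intro sum.neutral) auto
    qed
    finally show "dual g (delta J) I = P J I" .
  qed
  have lookup_g: "Poly_Mapping.lookup (g (bas I)) J = P J I" for I J
    by (metis dual_def ev_delta g_delta)
  have bij: "bij g"
    by (rule triangular_bij[OF g(1), of wt]; unfold lookup_g) (auto simp: P_diag dest!: P_nz)
  have hom: "homogeneous 0 g"
    unfolding homogeneous_def using P_nz by (auto simp: in_keys_iff lookup_g par_eq)
  have "dual g (conv (delta J) (delta K)) = conv (dual g (delta J)) (dual g (delta K))" for J K
  proof (cases "n1 J + n1 K \<le> 1")
    case True
    define L where "L = mon (n1 J + n1 K) (n2 J + n2 K) (n3 J + n3 K)"
    have L: "n1 L = n1 J + n1 K" "n2 L = n2 J + n2 K" "n3 L = n3 J + n3 K"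
      unfolding L_def by (rule n_mon; use True n_pos[of J] in linarith)+
    define r where "r = mfact L / (mfact J * mfact K)"
    have r: "C2 r * C2 (1 / mfact L) = C2 (1 / mfact J) * C2 (1 / mfact K)"
      by (simp add: r_def)
    have "conv (delta J) (delta K) = (\<lambda>I. r * delta L I)"
      using True by (simp add: conv_delta L_def r_def Let_def)
    then have 1: "dual g (conv (delta J) (delta K)) = (\<lambda>I. r * P L I)"
      by (simp only: dual_scaled g_delta)
    have v0: "V0 L = V0 J * V0 K" and v1: "V1 L = V0 J * V1 K + V1 J * V0 K"
      using True by (auto simp: V0_def V1_def L U_mult mult_ac)
    have s: "ser0 (\<lambda>I. r * P L I) = C2 (1 / mfact J) * C2 (1 / mfact K) * (V0 J * V0 K)"
      "ser1 (\<lambda>I. r * P L I) = C2 (1 / mfact J) * C2 (1 / mfact K) * (V0 J * V1 K + V1 J * V0 K)"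
      by (simp_all only: ser_scaled ser_P mult.assoc[symmetric] r v0 v1)
    have "(\<lambda>I. r * P L I) = conv (P J) (P K)"
      unfolding ser0_conv ser1_conv
      by (rule ser_eqI; unfold s ser0_conv ser1_conv ser_P) (simp_all only: mult_ac distrib_left)
    then show ?thesis
      by (simp only: 1 g_delta)
  next
    case False
    then have n: "n1 J \<noteq> 0" "n1 K \<noteq> 0"
      using n1_le[of J] n1_le[of K] by auto
    have "conv (P J) (P K) = (\<lambda>I. 0)"
      using n by (intro ser_eqI) (simp_all add: ser0_conv ser1_conv ser_P V0_def)
    then show ?thesis
      using False by (simp add: conv_delta g_delta dual_zero)
  qed
  then have mor: "\<forall>v. comult (g v) = tensor_map 0 g g (comult v)"
    by (rule comult_morphism_iff(2)[OF g(1)])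
  have "dual g x1 = unser 0 h" "dual g x2 = unser u2 0" "dual g x3 = unser u3 0"
    unfolding gen_defs g_delta P_def V0_def V1_def U_def by (simp_all add: mfact_def)
  moreover have "coalgebra_automorphism g"
    unfolding coalgebra_automorphism_def by (intro conjI g(1) bij hom mor)
  ultimately show ?thesis
    by (intro exI[of _ g] conjI)
qed

text \<open>The exchange of \<open>t\<^sub>2\<close> and \<open>t\<^sub>3\<close> has the wrong
  leading exponents for \<open>automorphism_of_coordinates\<close>. It is bijective as an
  involution, and on series it transposes the coefficients, which respects products.\<close>

lemma ex_swap_automorphism:
  "\<exists>\<sigma>. coalgebra_automorphism \<sigma> \<and> (\<forall>F I. dual \<sigma> F I = F (mon (n1 I) (n3 I) (n2 I)))"
proof -
  define sw where "sw = (\<lambda>I. mon (n1 I) (n3 I) (n2 I))"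
  have n_sw: "n1 (sw I) = n1 I" "n2 (sw I) = n3 I" "n3 (sw I) = n2 I" for I
    unfolding sw_def by (rule n_mon; use n1_le[of I] n_pos[of I] in linarith)+
  have sw_sw: "sw (sw I) = I" for I
    by (rule mono21_eqI) (simp_all add: n_sw)
  define tr :: "complex fps fps \<Rightarrow> complex fps fps" where "tr A = Abs_fps (\<lambda>i. Abs_fps (\<lambda>j. A $ j $ i))" for A
  have tr_mult: "tr (A * B) = tr A * tr B" for A B
    by (rule fps2_eqI) (simp add: tr_def fps2_mult_nth, rule sum.swap)
  have tr_add: "tr (A + B) = tr A + tr B" for A B
    by (rule fps2_eqI) (simp add: tr_def)
  have cf: "cf (\<lambda>I. F (sw I)) a b c = cf F a c b" for F a b c
    by (auto simp: cf_def sw_def add.commute)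
  have ser_sw: "ser0 (\<lambda>I. F (sw I)) = tr (ser0 F)" "ser1 (\<lambda>I. F (sw I)) = tr (ser1 F)" for F
    by (rule fps2_eqI; simp add: ser0_def ser1_def cf tr_def mult.commute)+
  have "\<exists>\<sigma>. lin \<sigma> \<and> dual \<sigma> = (\<lambda>F I. F (sw I))"
  proof (rule ex_dual)
    fix I
    show "\<exists>S. finite S \<and> (\<forall>F. (\<forall>J\<in>S. F J = 0) \<longrightarrow> F (sw I) = 0)"
      by (rule exI[of _ "{sw I}"]) simp
  qed auto
  then obtain \<sigma> where \<sigma>: "lin \<sigma>" "dual \<sigma> = (\<lambda>F I. F (sw I))"
    by blast
  have "\<sigma> \<circ> \<sigma> = id"
    by (rule lin_eqI) (simp_all add: lin_comp \<sigma>(1) dual_comp free_vs.linear_id, simp add: \<sigma>(2) sw_sw)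
  then have "bij \<sigma>"
    using o_bij by blast
  moreover have "dual \<sigma> (twist 1 F) = twist 1 (dual \<sigma> F)" for F
    by (simp add: \<sigma>(2) twist_def par_eq n_sw fun_eq_iff)
  moreover have "dual \<sigma> (conv F G) = conv (dual \<sigma> F) (dual \<sigma> G)" for F G
    unfolding \<sigma>(2) by (rule ser_eqI) (simp_all only: ser_sw ser0_conv ser1_conv tr_mult tr_add)
  ultimately show ?thesis
    using \<sigma> unfolding coalgebra_automorphism_iff sw_def by auto
qed

text \<open>This reduces a nonzero \<open>t\<^sub>3\<close> coefficient of \<open>f\<close>, or a
  nonzero constant term of \<open>b\<close>, to the corresponding case for \<open>t\<^sub>2\<close>
  and \<open>a\<close>.\<close>

lemma L_equiv_swap:
  assumes d: "d \<in> L_infinity" and rep: "represents d f a b" "f $ 0 $ 0 = 0"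
  shows "\<exists>d' f' a' b'. (d, d') \<in> L_equiv \<and> represents d' f' a' b' \<and> f' $ 0 $ 0 = 0 \<and>
    f' $ 1 $ 0 = f $ 0 $ 1 \<and> a' $ 0 $ 0 = b $ 0 $ 0"
proof -
  obtain \<sigma> where \<sigma>: "coalgebra_automorphism \<sigma>" "\<And>F I. dual \<sigma> F I = F (mon (n1 I) (n3 I) (n2 I))"
    using ex_swap_automorphism by blast
  then have lin: "lin \<sigma>" "bij \<sigma>"
    by (simp_all add: coalgebra_automorphism_def)
  have lin_d: "lin d"
    using d by (simp add: L_infinity_iff coderivation_def)
  define d' where "d' = inv \<sigma> \<circ> d \<circ> \<sigma>"
  have d': "d' \<in> L_infinity"
    unfolding d'_def by (rule L_infinity_conj[OF d \<sigma>(1)])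
  then have equiv: "(d, d') \<in> L_equiv"
    using d \<sigma>(1) by (auto simp: L_equiv_def d'_def)
  obtain f' a' b' where rep': "f' $ 0 $ 0 = 0" "represents d' f' a' b'"
    using coderivation_represents[of d'] d' by (auto simp: L_infinity_iff)
  have "dual \<sigma> x1 = x1" "dual \<sigma> x3 = x2"
  proof -
    show "dual \<sigma> x1 = x1"
    proof
      fix I
      have "mon (n1 I) (n3 I) (n2 I) = mon 1 0 0 \<longleftrightarrow> I = mon 1 0 0"
        using mon_inj[of "n1 I" "n3 I" "n2 I" 1 0 0] mon_inj[of "n1 I" "n2 I" "n3 I" 1 0 0] n1_le[of I] n_pos[of I]
        by auto
      then show "dual \<sigma> x1 I = x1 I"
        by (simp only: \<sigma>(2) gen_defs delta_def)
    qed
    show "dual \<sigma> x3 = x2"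
    proof
      fix I
      have "mon (n1 I) (n3 I) (n2 I) = mon 0 0 1 \<longleftrightarrow> I = mon 0 1 0"
        using mon_inj[of "n1 I" "n3 I" "n2 I" 0 0 1] mon_inj[of "n1 I" "n2 I" "n3 I" 0 1 0] n1_le[of I] n_pos[of I]
        by auto
      then show "dual \<sigma> x3 I = x2 I"
        by (simp only: \<sigma>(2) gen_defs delta_def)
    qed
  qed
  then have inv: "dual (inv \<sigma>) x1 = x1" "dual (inv \<sigma>) x2 = x3"
    using dual_inv(1)[OF lin] by metis+
  have dual_d': "dual d' F I = dual d (dual (inv \<sigma>) F) (mon (n1 I) (n3 I) (n2 I))" for F I
    unfolding d'_def using lin_inv[OF lin] lin_d by (simp add: dual_comp lin_comp \<sigma>(2))
  have "f' $ 1 $ 0 = f $ 0 $ 1"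
    unfolding represents_coeff[OF rep] represents_coeff[OF rep'(2,1)] dual_d' inv by simp
  moreover have "a' $ 0 $ 0 = b $ 0 $ 0"
    unfolding represents_coeff[OF rep] represents_coeff[OF rep'(2,1)] dual_d' inv by simp
  ultimately show ?thesis
    using equiv rep' by blast
qed

text \<open>The transposes of \<open>g \<circ> d\<close> and \<open>e \<circ> g\<close> are both
  derivations along the algebra map \<open>dual g\<close>, so comparing them on the coordinates
  suffices.\<close>

lemma intertwiningI:
  assumes d: "coderivation 1 d" and e: "coderivation 1 e" and g: "coalgebra_automorphism g"
    and gen: "dual d (dual g x1) = dual g (dual e x1)" "dual d (dual g x2) = dual g (dual e x2)"
      "dual d (dual g x3) = dual g (dual e x3)"
  shows "g \<circ> d = e \<circ> g"
proof -
  have D: "lin d" "\<And>F G. dual d (conv F G) = (\<lambda>I. conv (dual d F) G I + conv (twist 1 F) (dual d G) I)"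
    and E: "lin e" "\<And>F G. dual e (conv F G) = (\<lambda>I. conv (dual e F) G I + conv (twist 1 F) (dual e G) I)"
    using d e by (simp_all add: coderivation_iff)
  have G: "lin g" "\<And>F. dual g (twist 1 F) = twist 1 (dual g F)"
    "\<And>F G. dual g (conv F G) = conv (dual g F) (dual g G)"
    using g by (simp_all add: coalgebra_automorphism_iff)
  show ?thesis
  proof (rule lin_eq_by_generators)
    show "dual (g \<circ> d) (conv F F') = dual (e \<circ> g) (conv F F')"
      if "dual (g \<circ> d) F = dual (e \<circ> g) F" "dual (g \<circ> d) F' = dual (e \<circ> g) F'" for F F'
      using that unfolding dual_comp[OF G(1)] dual_comp[OF E(1)]
      by (simp only: G(2,3) D(2) E(2) dual_plus)
  qed (simp_all add: lin_comp D(1) E(1) G(1) dual_comp gen)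
qed

subsection \<open>Normal forms\<close>

text \<open>The coefficients of the powers of \<open>t\<^sub>2\<close> in the solution of the
  transport equation with initial value \<open>t\<^sub>3\<close>. The recursion solves the
  coefficient of \<open>t\<^sub>2^n\<close> in the equation for the next unknown.\<close>

fun transport_coeff :: "(nat \<Rightarrow> complex fps) \<Rightarrow> (nat \<Rightarrow> complex fps) \<Rightarrow> nat \<Rightarrow> complex fps" where
  "transport_coeff a b 0 = fps_X"
| "transport_coeff a b (Suc n) = - inverse (a 0) * fps_const (1 / of_nat (Suc n)) *
    ((\<Sum>k<n. of_nat (Suc k) * transport_coeff a b (Suc k) * a (n - k)) +
     (\<Sum>k\<le>n. fps_deriv (transport_coeff a b k) * b (n - k)))"

declare transport_coeff.simps [simp del]

lemma transport_equation:
  fixes a b :: "complex fps fps"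
  assumes "a $ 0 $ 0 \<noteq> 0"
  shows "\<exists>u. a * fps_deriv u + b * d3 u = 0 \<and> u $ 0 = fps_X"
proof -
  define v where "v = transport_coeff (fps_nth a) (fps_nth b)"
  define u where "u = Abs_fps v"
  have "(fps_deriv u * a + d3 u * b) $ n = 0" for n
  proof -
    \<comment> \<open>\<open>s\<close> collects all terms of the coefficient except the one with the
      new unknown \<open>v (Suc n)\<close>. The factor \<open>a $ 0\<close> there is invertible,
      having a nonzero constant term.\<close>
    define s where "s = (\<Sum>k<n. of_nat (Suc k) * v (Suc k) * a $ (n - k)) + (\<Sum>k\<le>n. fps_deriv (v k) * b $ (n - k))"
    have "of_nat (Suc n) * fps_const (1 / of_nat (Suc n)) = (1 :: complex fps)"
      by (simp only: fps_of_nat[symmetric] fps_const_mult) (simp del: of_nat_Suc)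
    moreover have "inverse (a $ 0) * a $ 0 = 1"
      using assms by (simp add: inverse_mult_eq_1)
    moreover have "v (Suc n) = - inverse (a $ 0) * fps_const (1 / of_nat (Suc n)) * s"
      unfolding v_def s_def by (rule transport_coeff.simps(2))
    ultimately have "of_nat (Suc n) * v (Suc n) * a $ 0 = - s"
      by (metis (no_types, lifting) mult.assoc mult.commute mult_1 mult_minus_left)
    moreover have "(fps_deriv u * a + d3 u * b) $ n = of_nat (Suc n) * v (Suc n) * a $ 0 + s"
    proof -
      have "(fps_deriv u * a) $ n = (\<Sum>k\<le>n. of_nat (Suc k) * v (Suc k) * a $ (n - k))"
        by (simp add: fps_mult_nth u_def atMost_atLeast0)
      also have "\<dots> = of_nat (Suc n) * v (Suc n) * a $ 0 + (\<Sum>k<n. of_nat (Suc k) * v (Suc k) * a $ (n - k))"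
        by (simp add: lessThan_Suc_atMost[symmetric] add.commute del: of_nat_Suc)
      finally show ?thesis
        by (simp add: s_def d3_def fps_mult_nth u_def atMost_atLeast0 add.assoc)
    qed
    ultimately show ?thesis
      by simp
  qed
  then have "a * fps_deriv u + b * d3 u = 0"
    by (intro fps_ext) (simp add: mult.commute)
  moreover have "u $ 0 = fps_X"
    by (simp add: u_def v_def transport_coeff.simps(1))
  ultimately show ?thesis
    by blast
qed

lemma represents_unser:
  assumes "represents d f a b" "f $ 0 $ 0 = 0" "A $ 0 $ 0 = 0"
  shows "dual d (unser A B) = unser (f * B) (a * fps_deriv A + b * d3 A)"
  using assms by (intro ser_eqI) (simp_all add: represents_def)

lemma psi_L_infinity: "psi_100_2 \<in> L_infinity" "psi_010_1 \<in> L_infinity"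
  using represents_L_infinity[OF psi_100_2] represents_L_infinity[OF psi_010_1] by simp_all

lemma L_equiv_psi_100_2_first_coeff:
  assumes d: "d \<in> L_infinity" and rep: "represents d f a b" "f $ 0 $ 0 = 0" and nz: "a $ 0 $ 0 \<noteq> 0"
  shows "(psi_100_2, d) \<in> L_equiv"
proof -
  have f: "f = 0"
    using L_infinity_represents[OF d rep(1)] nz by auto
  obtain u where u: "a * fps_deriv u + b * d3 u = 0" "u $ 0 = fps_X"
    using transport_equation[OF nz] by blast
  have "\<exists>g. coalgebra_automorphism g \<and>
    dual g x1 = unser 0 a \<and> dual g x2 = unser fps_X 0 \<and> dual g x3 = unser u 0"
  proof (rule automorphism_of_coordinates)
    \<comment> \<open>The linear part of \<open>u\<close> is \<open>t\<^sub>3\<close> plus a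
      multiple of \<open>t\<^sub>2\<close>, so \<open>t\<^sub>2\<close> must be the heavier
      variable.\<close>
    show "leading 3 2 (a $ 0 $ 0) 0 0 a"
      by (simp add: leading_def)
    show "leading 3 2 1 1 0 fps_X"
      by (auto simp: leading_def fps_X_def)
    show "leading 3 2 1 0 1 u"
      unfolding leading_def
    proof (intro allI impI)
      fix i j :: nat assume "3 * i + 2 * j \<le> 3 * 0 + 2 * 1"
      then have "i = 0" "j \<le> 1"
        by auto
      then show "u $ i $ j = (if i = 0 \<and> j = 1 then 1 else 0)"
        using u(2) by (auto simp: fps_X_def)
    qed
  qed (use nz in auto)
  then obtain g where g: "coalgebra_automorphism g" "dual g x1 = unser 0 a" "dual g x2 = unser fps_X 0"
    "dual g x3 = unser u 0"
    by blast
  have c: "coderivation 1 d"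
    using d by (simp add: L_infinity_iff)
  have "g \<circ> d = psi_100_2 \<circ> g"
    using u represents_generators[OF psi_100_2(2)] represents_generators[OF rep] represents_unser[OF rep]
    by (intro intertwiningI[OF c psi_100_2(1) g(1)]) (simp_all add: g unser_gen f dual_zero)
  then show ?thesis
    by (intro L_equivI[OF psi_L_infinity(1) d g(1)])
qed

lemma L_equiv_psi_010_1_first_coeff:
  assumes d: "d \<in> L_infinity" and rep: "represents d f a b" "f $ 0 $ 0 = 0" and nz: "f $ 1 $ 0 \<noteq> 0"
  shows "(psi_010_1, d) \<in> L_equiv"
proof -
  have ab: "a = 0" "b = 0"
    using L_infinity_represents[OF d rep(1)] nz by auto
  have "\<exists>g. coalgebra_automorphism g \<and>
    dual g x1 = unser 0 1 \<and> dual g x2 = unser f 0 \<and> dual g x3 = unser (fps_const fps_X) 0"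
  proof (rule automorphism_of_coordinates)
    \<comment> \<open>Now \<open>f\<close> may contain a multiple of \<open>t\<^sub>3\<close> beside
      its \<open>t\<^sub>2\<close> term, so the weights are exchanged.\<close>
    show "leading 2 3 1 0 0 1"
      by (simp add: leading_def)
    show "leading 2 3 (f $ 1 $ 0) 1 0 f"
      unfolding leading_def
    proof (intro allI impI)
      fix i j :: nat assume "2 * i + 3 * j \<le> 2 * 1 + 3 * 0"
      then have "j = 0" "i \<le> 1"
        by auto
      then show "f $ i $ j = (if i = 1 \<and> j = 0 then f $ 1 $ 0 else 0)"
        using rep(2) by (cases i) auto
    qed
    show "leading 2 3 1 0 1 (fps_const fps_X)"
      by (auto simp: leading_def fps_X_def)
  qed (use nz in auto)
  then obtain g where g: "coalgebra_automorphism g" "dual g x1 = unser 0 1" "dual g x2 = unser f 0"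
    "dual g x3 = unser (fps_const fps_X) 0"
    by blast
  have c: "coderivation 1 d"
    using d by (simp add: L_infinity_iff)
  have "g \<circ> d = psi_010_1 \<circ> g"
    using represents_generators[OF psi_010_1(2)] represents_generators[OF rep] represents_unser[OF rep]
    by (intro intertwiningI[OF c psi_010_1(1) g(1)]) (simp_all add: g rep(2) unser_gen ab dual_zero)
  then show ?thesis
    by (intro L_equivI[OF psi_L_infinity(2) d g(1)])
qed

lemma L_equiv_psi_100_2:
  assumes d: "d \<in> L_infinity" and rep: "represents d f a b" "f $ 0 $ 0 = 0"
    and nz: "a $ 0 $ 0 \<noteq> 0 \<or> b $ 0 $ 0 \<noteq> 0"
  shows "(psi_100_2, d) \<in> L_equiv"
proof (cases "a $ 0 $ 0 = 0")
  case True
  obtain d' f' a' b' where d': "(d, d') \<in> L_equiv" "represents d' f' a' b'" "f' $ 0 $ 0 = 0"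
    "a' $ 0 $ 0 = b $ 0 $ 0"
    using L_equiv_swap[OF d rep] by blast
  then have "(psi_100_2, d') \<in> L_equiv"
    using nz True by (intro L_equiv_psi_100_2_first_coeff[OF _ d'(2,3)]) (auto simp: L_equiv_def)
  then show ?thesis
    using d'(1) L_equiv_sym L_equiv_trans by blast
qed (rule L_equiv_psi_100_2_first_coeff[OF d rep])

lemma L_equiv_psi_010_1:
  assumes d: "d \<in> L_infinity" and rep: "represents d f a b" "f $ 0 $ 0 = 0"
    and nz: "f $ 1 $ 0 \<noteq> 0 \<or> f $ 0 $ 1 \<noteq> 0"
  shows "(psi_010_1, d) \<in> L_equiv"
proof (cases "f $ 1 $ 0 = 0")
  case True
  obtain d' f' a' b' where d': "(d, d') \<in> L_equiv" "represents d' f' a' b'" "f' $ 0 $ 0 = 0"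
    "f' $ 1 $ 0 = f $ 0 $ 1"
    using L_equiv_swap[OF d rep] by blast
  have "f' $ 1 $ 0 \<noteq> 0"
    unfolding d'(4) using nz True by blast
  then have "(psi_010_1, d') \<in> L_equiv"
    using d'(1) by (intro L_equiv_psi_010_1_first_coeff[OF _ d'(2,3)]) (auto simp: L_equiv_def)
  then show ?thesis
    using d'(1) L_equiv_sym L_equiv_trans by blast
qed (rule L_equiv_psi_010_1_first_coeff[OF d rep])

lemma psi_not_equiv: "(psi_100_2, psi_010_1) \<notin> L_equiv"
proof
  assume "(psi_100_2, psi_010_1) \<in> L_equiv"
  then obtain g where g: "coalgebra_automorphism g" and eq: "psi_010_1 = inv g \<circ> psi_100_2 \<circ> g"
    by (auto simp: L_equiv_def)
  have G: "lin g" "bij g" "dual g (twist 1 x1) = twist 1 (dual g x1)"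
    using g by (auto simp: coalgebra_automorphism_iff)
  have lin: "lin psi_100_2"
    using psi_100_2 by (simp add: coderivation_def)
  have "g \<circ> psi_010_1 = psi_100_2 \<circ> g"
    using G(2) by (simp add: eq fun_eq_iff bij_is_surj surj_f_inv_f)
  then have "dual psi_010_1 (dual g x2) = dual g (dual psi_100_2 x2)"
    by (metis dual_comp G(1) lin)
  also have "dual psi_100_2 x2 = x1"
    by (simp add: represents_generators[OF psi_100_2(2)] unser_gen)
  finally have "dual g x1 = dual psi_010_1 (dual g x2)" ..
  then have 1: "ser1 (dual g x1) = 0"
    using psi_010_1(2) by (simp add: represents_def)
  have "twist 1 x1 = (\<lambda>I. - x1 I)"
    by (rule ser_eqI; simp only: ser_twist ser_minus ser_gen minus_zero)
  \<comment> \<open>An even \<open>g\<close> keeps \<open>x1\<close> odd, so the even part of its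
    image equals its own negative. Together with \<open>1\<close> the image vanishes, against the
    injectivity of \<open>dual g\<close>.\<close>
  then have "ser0 (twist 1 (dual g x1)) = ser0 (\<lambda>I. - dual g x1 I)"
    using G(3) by (simp only: dual_minus)
  then have "ser0 (dual g x1) = 0"
    unfolding ser_twist ser_minus by (rule fps2_neg_eq)
  with 1 have "dual g x1 = (\<lambda>I. 0)"
    by (intro ser_eqI) simp_all
  then have "x1 = (\<lambda>I. 0)"
    using dual_inv(1)[OF G(1,2), of x1] by (simp add: dual_zero)
  then have "ser1 x1 = ser1 (\<lambda>I. 0)"
    by (rule arg_cong)
  then show False
    by (simp only: ser_gen ser_zero) simp
qed

theorem mainTheorem1:
  shows "(\<forall>d :: basis21 sym \<Rightarrow> basis21 sym.
            d \<in> L_infinity \<and> L_term 1 d \<noteq> (\<lambda>v. 0) \<longrightarrow>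
              (d, coder_of 1 (L_term 1 d)) \<in> L_equiv \<and>
              ((d, psi_100_2) \<in> L_equiv \<or> (d, psi_010_1) \<in> L_equiv) \<and>
              \<not> ((d, psi_100_2) \<in> L_equiv \<and> (d, psi_010_1) \<in> L_equiv))
       \<and> card ({d :: basis21 sym \<Rightarrow> basis21 sym.
                  d \<in> L_infinity \<and> L_term 1 d \<noteq> (\<lambda>v. 0)} // L_equiv) = 2"
proof -
  let ?A = "{d :: basis21 sym \<Rightarrow> basis21 sym. d \<in> L_infinity \<and> L_term 1 d \<noteq> (\<lambda>v. 0)}"
  \<comment> \<open>The normal form depends only on the linear data, which \<open>d\<close> shares
    with its leading term; both are therefore equivalent to the same \<open>psi\<close>.\<close>
  have normal_form: "(psi, d) \<in> L_equiv \<and> (psi, coder_of 1 (L_term 1 d)) \<in> L_equiv"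
    if d: "d \<in> L_infinity" and rep: "represents d f a b" "f $ 0 $ 0 = 0"
      and psi: "psi = psi_100_2 \<and> (a $ 0 $ 0 \<noteq> 0 \<or> b $ 0 $ 0 \<noteq> 0) \<or>
        psi = psi_010_1 \<and> (f $ 1 $ 0 \<noteq> 0 \<or> f $ 0 $ 1 \<noteq> 0)" for d f a b psi
  proof -
    have "coderivation 1 d"
      using d by (simp add: L_infinity_iff)
    then obtain f' where f': "represents (coder_of 1 (L_term 1 d)) f' (C2 (a $ 0 $ 0)) (C2 (b $ 0 $ 0))"
      "coderivation 1 (coder_of 1 (L_term 1 d))" "\<And>i j. f' $ i $ j = (if i + j = 1 then f $ i $ j else 0)"
      using leading_term[OF _ rep] by blast
    have f'0: "f' $ 0 $ 0 = 0"
      by (simp add: f'(3))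
    \<comment> \<open>The alternative \<open>f = 0\<close> or \<open>a = b = 0\<close> passes to the
      truncations, so the leading term is itself a codifferential.\<close>
    have "f' = 0 \<or> C2 (a $ 0 $ 0) = 0 \<and> C2 (b $ 0 $ 0) = 0"
      using L_infinity_represents[OF d rep(1)]
    proof
      assume "f = 0"
      then have "f' = 0"
        by (intro fps2_eqI) (simp add: f'(3))
      then show ?thesis ..
    qed auto
    then have d1: "coder_of 1 (L_term 1 d) \<in> L_infinity"
      by (rule represents_L_infinity[OF f'(2,1)])
    show ?thesis
      using psi
    proof
      assume p: "psi = psi_100_2 \<and> (a $ 0 $ 0 \<noteq> 0 \<or> b $ 0 $ 0 \<noteq> 0)"
      then show ?thesis
        using L_equiv_psi_100_2[OF d rep] L_equiv_psi_100_2[OF d1 f'(1) f'0] by simp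
    next
      assume p: "psi = psi_010_1 \<and> (f $ 1 $ 0 \<noteq> 0 \<or> f $ 0 $ 1 \<noteq> 0)"
      then have "f' $ 1 $ 0 \<noteq> 0 \<or> f' $ 0 $ 1 \<noteq> 0"
        by (simp add: f'(3))
      with p show ?thesis
        using L_equiv_psi_010_1[OF d rep] L_equiv_psi_010_1[OF d1 f'(1) f'0] by simp
    qed
  qed
  have main: "(d, coder_of 1 (L_term 1 d)) \<in> L_equiv \<and> ((psi_100_2, d) \<in> L_equiv \<or> (psi_010_1, d) \<in> L_equiv)"
    if "d \<in> ?A" for d
  proof -
    have d: "d \<in> L_infinity" "coderivation 1 d" "L_term 1 d \<noteq> (\<lambda>v. 0)"
      using that by (simp_all add: L_infinity_iff)
    obtain f a b where rep: "f $ 0 $ 0 = 0" "represents d f a b"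
      using coderivation_represents[OF d(2)] by blast
    then have "f $ 1 $ 0 \<noteq> 0 \<or> f $ 0 $ 1 \<noteq> 0 \<or> a $ 0 $ 0 \<noteq> 0 \<or> b $ 0 $ 0 \<noteq> 0"
      using L_term_nonzero[OF d(2)] d(3) by blast
    then obtain psi where "psi = psi_100_2 \<and> (a $ 0 $ 0 \<noteq> 0 \<or> b $ 0 $ 0 \<noteq> 0) \<or>
        psi = psi_010_1 \<and> (f $ 1 $ 0 \<noteq> 0 \<or> f $ 0 $ 1 \<noteq> 0)"
      by blast
    moreover from normal_form[OF d(1) rep(2,1) this]
    have "(psi, d) \<in> L_equiv" "(d, coder_of 1 (L_term 1 d)) \<in> L_equiv"
      by (auto intro: L_equiv_trans[OF L_equiv_sym])
    ultimately show ?thesis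
      by auto
  qed
  have psi: "psi_100_2 \<in> ?A" "psi_010_1 \<in> ?A"
    using psi_L_infinity L_term_nonzero[OF psi_100_2] L_term_nonzero[OF psi_010_1] by simp_all
  have not_both: "\<not> ((psi_100_2, d) \<in> L_equiv \<and> (psi_010_1, d) \<in> L_equiv)" for d
    using psi_not_equiv L_equiv_trans[OF _ L_equiv_sym] by metis
  have class_eq: "L_equiv `` {d} = L_equiv `` {e}" if "(d, e) \<in> L_equiv"
    for d e :: "basis21 sym \<Rightarrow> basis21 sym"
    using L_equiv_trans[OF that] L_equiv_trans[OF L_equiv_sym[OF that]] by auto
  have "?A // L_equiv = {L_equiv `` {psi_100_2}, L_equiv `` {psi_010_1}}"
  proof
    show "?A // L_equiv \<subseteq> {L_equiv `` {psi_100_2}, L_equiv `` {psi_010_1}}"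
    proof
      fix X assume "X \<in> ?A // L_equiv"
      then obtain d where "d \<in> ?A" "X = L_equiv `` {d}"
        by (rule quotientE)
      then show "X \<in> {L_equiv `` {psi_100_2}, L_equiv `` {psi_010_1}}"
        using main[of d] class_eq by blast
    qed
    show "{L_equiv `` {psi_100_2}, L_equiv `` {psi_010_1}} \<subseteq> ?A // L_equiv"
      using psi by (auto intro: quotientI)
  qed
  moreover have "L_equiv `` {psi_100_2} \<noteq> L_equiv `` {psi_010_1}"
  proof
    assume "L_equiv `` {psi_100_2} = L_equiv `` {psi_010_1}"
    \<comment> \<open>Reflexivity comes from \<open>main\<close> applied to
      \<open>psi_010_1\<close>, whose other alternative is excluded by
      \<open>psi_not_equiv\<close>.\<close>
    moreover have "(psi_010_1, psi_010_1) \<in> L_equiv"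
      using main[OF psi(2)] not_both[of psi_010_1] psi_not_equiv by blast
    ultimately show False
      using psi_not_equiv by blast
  qed
  ultimately have "card (?A // L_equiv) = 2"
    by simp
  moreover have "\<not> ((d, psi_100_2) \<in> L_equiv \<and> (d, psi_010_1) \<in> L_equiv)" for d
    using not_both L_equiv_sym by blast
  ultimately show ?thesis
    using main L_equiv_sym by blast
qed

end
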